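(* Let $m\ge3$ and let $\mathsf S(\mathbf d^m)$ be the numerical semigroup minimally generated by $\mathbf d^m=\{d_1,\dots,d_m\}$, $\gcd(d_1,\dots,d_m)=1$, with Hilbert series $$H(\mathbf d^m;z)=\sum_{s\in\mathsf S(\mathbf d^m)}z^s=\frac{Q(\mathbf d^m;z)}{\prod_{i=1}^m(1-z^{d_i})},\qquad Q(\mathbf d^m;z)=1+\sum_{i=1}^{m-1}(-1)^i\sum_{j=1}^{\beta_i(\mathbf d^m)}z^{C_{j,i}},$$ where $\beta_i(\mathbf d^m)$ are the Betti numbers and $C_{j,i}$ the degrees of the syzygies of the $i$th kind. For a positive integer $q$ let $\omega_q$ be the number of generators $d_i\in\mathbf d^m$ divisible by $q$. Then for every integer $q$ with $1<q\le\max\{d_1,\dots,d_m\}$ and $\omega_q\ge1$, and every integer $n$ with $\gcd(n,q)=1$, $1\le n<q/2$, the following identities hold (with $\mathrm i=\sqrt{-1}$): for $r=1,\dots,\omega_q-1$, $$\sum_{k=1}^{m-1}(-1)^{k-1}\sum_{j=1}^{\beta_k(\mathbf d^m)}C_{j,k}^r\exp\left(\mathrm i\frac{2\pi n}{q}C_{j,k}\right)=0,$$ and, in the case $r=0$, $$\sum_{k=1}^{m-1}(-1)^{k-1}\sum_{j=1}^{\beta_k(\mathbf d^m)}\exp\left(\mathrm i\frac{2\pi n}{q}C_{j,k}\right)=1.$$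
   Context: $\mathsf S(\mathbf d^m)=\{\sum_{i=1}^m x_id_i : x_i\in\mathbb Z_{\ge0}\}$ is a numerical semigroup generated by a minimal set of positive integers $d_1<\dots<d_m$ with $\gcd(d_1,\dots,d_m)=1$; minimal means that no $d_i$ is a nonnegative integer combination of the others. Its Hilbert series is a rational function $Q(\mathbf d^m;z)/\prod_{i=1}^m(1-z^{d_i})$ with polynomial numerator $Q=1-Q_1+Q_2-\dots+(-1)^{m-1}Q_{m-1}$, $Q_i=\sum_{j=1}^{\beta_i(\mathbf d^m)}z^{C_{j,i}}$. Here $\beta_i(\mathbf d^m)$ is the $i$th Betti number and the positive integers $C_{j,i}$, $1\le j\le\beta_i(\mathbf d^m)$ (listed with multiplicity, in nondecreasing order in $j$), are the degrees of the syzygies of the $i$th kind in a minimal free resolution of the semigroup ring. The convention is that all cancellations of terms $z^{C_{j,i}}$ with opposite signs in $Q$ are already performed, i.e. $C_{j,i}\ne C_{r,i+2k-1}$ for $1\le k\le\lfloor (m-i)/2\rfloor$. *)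

theory Defs
  imports Complex_Main "HOL-Library.Poly_Mapping" "HOL-Library.Multiset"
    "HOL-Computational_Algebra.Polynomial"
begin

definition gen_semigroup :: "nat \<Rightarrow> (nat \<Rightarrow> nat) \<Rightarrow> nat set" where
  "gen_semigroup m d = {\<Sum>i=1..m. x i * d i | x :: nat \<Rightarrow> nat. True}"

definition minimal_generators :: "nat \<Rightarrow> (nat \<Rightarrow> nat) \<Rightarrow> bool" where
  "minimal_generators m d \<longleftrightarrow>
     (\<forall>i\<in>{1..m}. 0 < d i) \<and> strict_mono_on {1..m} d \<and> Gcd (d ` {1..m}) = 1 \<and>
     (\<forall>i\<in>{1..m}. \<not> (\<exists>x :: nat \<Rightarrow> nat. d i = (\<Sum>j\<in>{1..m} - {i}. x j * d j)))"

definition omega :: "nat \<Rightarrow> (nat \<Rightarrow> nat) \<Rightarrow> nat \<Rightarrow> nat" where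
  "omega m d q = card {i\<in>{1..m}. q dvd d i}"

text \<open>Polynomials in the variables x_1, x_2, ...: a polynomial maps an exponent vector
  (a finitely supported function of the variable index) to its coefficient.
  \<open>poly_ring m\<close> is the subring k[x_1, ..., x_m].\<close>

type_synonym 'k mpoly = "(nat \<Rightarrow>\<^sub>0 nat) \<Rightarrow>\<^sub>0 'k"

definition poly_ring :: "nat \<Rightarrow> ('k::field) mpoly set" where
  "poly_ring m = {p. \<forall>\<alpha>\<in>Poly_Mapping.keys p. Poly_Mapping.keys \<alpha> \<subseteq> {1..m}}"

text \<open>The grading in which x_i has degree d_i.\<close>

definition wdeg :: "(nat \<Rightarrow> nat) \<Rightarrow> (nat \<Rightarrow>\<^sub>0 nat) \<Rightarrow> nat" where
  "wdeg d \<alpha> = (\<Sum>i\<in>Poly_Mapping.keys \<alpha>. Poly_Mapping.lookup \<alpha> i * d i)"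

text \<open>The semigroup ring k[S] as a subring of k[t], and the k-algebra homomorphism
  from k[x_1, ..., x_m] to k[t] that sends x_i to t^(d_i).\<close>

definition semigroup_ring :: "nat set \<Rightarrow> ('k::field) poly set" where
  "semigroup_ring S = {f. \<forall>s. coeff f s \<noteq> 0 \<longrightarrow> s \<in> S}"

definition semigroup_hom :: "(nat \<Rightarrow> nat) \<Rightarrow> ('k::field) mpoly \<Rightarrow> 'k poly" where
  "semigroup_hom d p =
     (\<Sum>\<alpha>\<in>Poly_Mapping.keys p. monom (Poly_Mapping.lookup p \<alpha>) (wdeg d \<alpha>))"

text \<open>The free module of rank b over k[x_1, ..., x_m], with coordinates indexed by 1, ..., b.\<close>

definition free_module :: "nat \<Rightarrow> nat \<Rightarrow> (nat \<Rightarrow> ('k::field) mpoly) set" where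
  "free_module m b = {v. (\<forall>j\<in>{1..b}. v j \<in> poly_ring m) \<and> (\<forall>j. j \<notin> {1..b} \<longrightarrow> v j = 0)}"

text \<open>The map of free modules, from rank b to rank b', given by a b' x b matrix.\<close>

definition mat_map ::
  "nat \<Rightarrow> nat \<Rightarrow> (nat \<Rightarrow> nat \<Rightarrow> ('k::field) mpoly) \<Rightarrow> (nat \<Rightarrow> 'k mpoly) \<Rightarrow> (nat \<Rightarrow> 'k mpoly)" where
  "mat_map b' b A v = (\<lambda>a. if a \<in> {1..b'} then (\<Sum>j=1..b. A a j * v j) else 0)"

text \<open>A minimal graded free resolution
  \[ \cdots \to F_2 \to F_1 \to F_0 = k[x_1,\dots,x_m] \to k[S] \to 0. \]
  The module F_k has b k generators, of degrees E 1 k, ..., E (b k) k, and M k is the matrix of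
  the differential from F_k to F_(k-1). No bound on the length is imposed. The differentials
  preserve degrees, and minimality says that their entries lie in the ideal (x_1, ..., x_m),
  i.e. have no constant term.\<close>

definition minimal_free_resolution ::
  "nat \<Rightarrow> (nat \<Rightarrow> nat) \<Rightarrow> (nat \<Rightarrow> nat) \<Rightarrow> (nat \<Rightarrow> nat \<Rightarrow> nat) \<Rightarrow>
   (nat \<Rightarrow> nat \<Rightarrow> nat \<Rightarrow> ('k::field) mpoly) \<Rightarrow> bool" where
  "minimal_free_resolution m d b E M \<longleftrightarrow>
     b 0 = 1 \<and> E 1 0 = 0 \<and>
     (\<forall>k\<ge>1. \<forall>a\<in>{1..b (k - 1)}. \<forall>j\<in>{1..b k}.
        M k a j \<in> poly_ring m \<and>
        (\<forall>\<alpha>\<in>Poly_Mapping.keys (M k a j). E a (k - 1) + wdeg d \<alpha> = E j k) \<and>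
        Poly_Mapping.lookup (M k a j) 0 = 0) \<and>
     semigroup_hom d ` (poly_ring m :: 'k mpoly set) = semigroup_ring (gen_semigroup m d) \<and>
     {v \<in> free_module m (b 0). semigroup_hom d (v 1) = 0}
       = mat_map (b 0) (b 1) (M 1) ` free_module m (b 1) \<and>
     (\<forall>k\<ge>1. {v \<in> free_module m (b k). mat_map (b (k - 1)) (b k) (M k) v = (\<lambda>_. 0)}
       = mat_map (b k) (b (k + 1)) (M (k + 1)) ` free_module m (b (k + 1)))"

definition degrees :: "(nat \<Rightarrow> nat) \<Rightarrow> (nat \<Rightarrow> nat \<Rightarrow> nat) \<Rightarrow> nat \<Rightarrow> nat multiset" where
  "degrees b E k = image_mset (\<lambda>j. E j k) (mset_set {1..b k})"

text \<open>Cancelling one pair of terms z^t of opposite signs in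
  Q = 1 - Q_1 + Q_2 - ... + (-1)^(m-1) Q_(m-1), one from Q_k and one from Q_l.\<close>

definition cancel_step :: "nat \<Rightarrow> (nat \<Rightarrow> nat multiset) \<Rightarrow> (nat \<Rightarrow> nat multiset) \<Rightarrow> bool" where
  "cancel_step m D D' \<longleftrightarrow>
     (\<exists>k\<in>{1..m-1}. \<exists>l\<in>{1..m-1}. \<exists>t. odd (k + l) \<and> t \<in># D k \<and> t \<in># D l \<and>
        D' = D(k := D k - {#t#}, l := D l - {#t#}))"

text \<open>\<open>syzygy_degrees m d b E M \<beta> C\<close>: the numbers C j k (1 \<le> j \<le> \<beta> k), nondecreasing in j,
  are the degrees of the syzygies of the k-th kind read off from the given minimal free
  resolution, under the convention that all terms of opposite signs in Q have been cancelled.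
  If nothing cancels, \<beta> k = b k is the k-th Betti number.\<close>

definition syzygy_degrees ::
  "nat \<Rightarrow> (nat \<Rightarrow> nat) \<Rightarrow> (nat \<Rightarrow> nat) \<Rightarrow> (nat \<Rightarrow> nat \<Rightarrow> nat) \<Rightarrow>
   (nat \<Rightarrow> nat \<Rightarrow> nat \<Rightarrow> ('k::field) mpoly) \<Rightarrow> (nat \<Rightarrow> nat) \<Rightarrow> (nat \<Rightarrow> nat \<Rightarrow> nat) \<Rightarrow> bool" where
  "syzygy_degrees m d b E M \<beta> C \<longleftrightarrow>
     minimal_free_resolution m d b E M \<and>
     (cancel_step m)\<^sup>*\<^sup>* (degrees b E) (degrees \<beta> C) \<and>
     (\<forall>i\<in>{1..m-1}. \<forall>k\<in>{1..(m - i) div 2}. \<forall>j\<in>{1..\<beta> i}. \<forall>r\<in>{1..\<beta> (i + 2 * k - 1)}.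
        C j i \<noteq> C r (i + 2 * k - 1)) \<and>
     (\<forall>k\<in>{1..m-1}. mono_on {1..\<beta> k} (\<lambda>j. C j k))"

end

theory Submission
  imports Defs "HOL-Library.Function_Algebras" "HOL-Computational_Algebra.Polynomial_FPS"
begin

text \<open>The identities say that the numerator $Q$ of the Hilbert series has a zero of multiplicity at
  least $\omega_q$ at $\zeta = \exp(2\pi i n/q)$: applying $z \frac{d}{dz}$ to $Q$ exactly \<open>r\<close> times and
  evaluating at $\zeta$ gives $0$ for $r < \omega_q$, and the summand $1$ of $Q$ accounts for the
  right-hand side when $r = 0$. The multiplicity is visible from
  $Q(z) = H(z) \prod_i (1 - z^{d_i})$: the $\omega_q$ factors with $q \mid d_i$ vanish at
  $\zeta$, while $H$, which is $1/(1-z)$ minus the polynomial of the gaps, has no pole at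
  $\zeta \ne 1$ (\<open>numerator_multiple_root\<close>). Cancelling terms of opposite sign does not change
  alternating sums (\<open>cancellation_alternating_sum\<close>), so the degrees of any minimal free resolution
  may be used.

  It remains to see that $1 + \sum_{k=1}^{m-1} (-1)^k \sum_j z^{E_{j,k}}$ really is $Q$ when the
  degrees $E_{j,k}$ come from a minimal free resolution whose length is not bounded in advance. Two
  facts are needed.

  The resolution has no terms in homological degree $\ge m$ (\<open>Betti_number_eq_0\<close>). The
  resolution is reduced modulo $x_1$, then modulo $x_2$, and so on up to $x_m$. Modulo $x_1$ it
  stays exact in all positive degrees, because $x_1$ acts injectively on the semigroup ring; each
  further variable destroys exactness in at most one more degree
  (\<open>exact_modulo_variables\<close>). So modulo all variables the complex is exact from degree $m$ on;
  but by minimality its differentials are then zero, so its terms must vanish there.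

  In each degree \<open>s\<close> the alternating sum of the dimensions of the homogeneous parts is 1 or 0
  according to whether \<open>s\<close> lies in the semigroup (\<open>Euler_characteristic_piece\<close>). Counting monomials
  turns this into the identity of power series for $Q$ (\<open>fps_of_numerator\<close>).\<close>

section \<open>Monomial parts of polynomials\<close>

definition part :: "('a \<Rightarrow> bool) \<Rightarrow> ('a \<Rightarrow>\<^sub>0 'b::comm_monoid_add) \<Rightarrow> 'a \<Rightarrow>\<^sub>0 'b" where
  "part P p = (\<Sum>\<alpha> | \<alpha> \<in> Poly_Mapping.keys p \<and> P \<alpha>. Poly_Mapping.single \<alpha> (Poly_Mapping.lookup p \<alpha>))"

lemma lookup_part:
  "Poly_Mapping.lookup (part P p) \<alpha> = (if P \<alpha> then Poly_Mapping.lookup p \<alpha> else 0)"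
proof -
  have "Poly_Mapping.lookup (part P p) \<alpha> =
      (\<Sum>\<beta> | \<beta> \<in> Poly_Mapping.keys p \<and> P \<beta>. if \<beta> = \<alpha> then Poly_Mapping.lookup p \<alpha> else 0)"
    unfolding part_def lookup_sum by (intro sum.cong) (auto simp: lookup_single when_def)
  also have "\<dots> = (if P \<alpha> then Poly_Mapping.lookup p \<alpha> else 0)"
    by (subst sum.delta) (auto simp: in_keys_iff)
  finally show ?thesis .
qed

lemma keys_part: "Poly_Mapping.keys (part P p) = {\<alpha> \<in> Poly_Mapping.keys p. P \<alpha>}"
  by (auto simp: in_keys_iff lookup_part split: if_splits)

lemma part_id: "(\<And>\<alpha>. \<alpha> \<in> Poly_Mapping.keys p \<Longrightarrow> P \<alpha>) \<Longrightarrow> part P p = p"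
  by (rule poly_mapping_eqI) (auto simp: lookup_part in_keys_iff)

lemma part_eq_0: "(\<And>\<alpha>. \<alpha> \<in> Poly_Mapping.keys p \<Longrightarrow> \<not> P \<alpha>) \<Longrightarrow> part P p = 0"
  by (rule poly_mapping_eqI) (auto simp: lookup_part in_keys_iff)

lemma part_0: "part P 0 = 0"
  by (simp add: part_def)

lemma part_add: "part P (p + q) = part P p + part P q"
  by (rule poly_mapping_eqI) (auto simp: lookup_part lookup_add)

lemma part_sum: "part P (sum f A) = (\<Sum>x\<in>A. part P (f x))"
  by (rule poly_mapping_eqI) (auto simp: lookup_part lookup_sum)

lemma part_split: "p = part P p + part (\<lambda>\<alpha>. \<not> P \<alpha>) p"
  by (rule poly_mapping_eqI) (auto simp: lookup_part lookup_add)

lemma sum_monomials: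
  "(\<Sum>\<alpha>\<in>Poly_Mapping.keys p. Poly_Mapping.single \<alpha> (Poly_Mapping.lookup p \<alpha>)) = p"
  using part_id[of p "\<lambda>_. True"] by (simp add: part_def)

lemma keys_sum_subset: "Poly_Mapping.keys (sum f A) \<subseteq> (\<Union>x\<in>A. Poly_Mapping.keys (f x))"
proof
  fix \<alpha> assume "\<alpha> \<in> Poly_Mapping.keys (sum f A)"
  then have "(\<Sum>x\<in>A. Poly_Mapping.lookup (f x) \<alpha>) \<noteq> 0" by (simp add: in_keys_iff lookup_sum)
  then obtain x where "x \<in> A" "Poly_Mapping.lookup (f x) \<alpha> \<noteq> 0" by (meson sum.neutral)
  then show "\<alpha> \<in> (\<Union>x\<in>A. Poly_Mapping.keys (f x))" by (auto simp: in_keys_iff)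
qed

text \<open>Every monomial of \<open>A\<close> sends exponents inside \<open>P\<close> to exponents inside \<open>P'\<close> and those outside
  to those outside, so no cancellation can occur between the two halves of the product. With
  \<open>P\<close> and \<open>P'\<close> fixing a weighted degree this says that multiplication by a homogeneous
  polynomial shifts the grading; with \<open>P = P'\<close> membership in a monomial ideal it gives
  cancellation modulo that ideal.\<close>

lemma part_mult:
  fixes A p :: "'a::monoid_add \<Rightarrow>\<^sub>0 'b::semiring_0"
  assumes "\<And>\<alpha> \<beta>. \<alpha> \<in> Poly_Mapping.keys A \<Longrightarrow> P' (\<alpha> + \<beta>) \<longleftrightarrow> P \<beta>"
  shows "part P' (A * p) = A * part P p"
proof -
  have "part P' (A * p) = part P' (A * part P p) + part P' (A * part (\<lambda>\<alpha>. \<not> P \<alpha>) p)"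
    by (subst (1) part_split[of p P]) (simp add: distrib_left part_add)
  moreover have "part P' (A * part P p) = A * part P p"
    using keys_mult[of A "part P p"] assms by (intro part_id) (auto simp: keys_part)
  moreover have "part P' (A * part (\<lambda>\<alpha>. \<not> P \<alpha>) p) = 0"
    using keys_mult[of A "part (\<lambda>\<alpha>. \<not> P \<alpha>) p"] assms
    by (intro part_eq_0) (auto simp: keys_part)
  ultimately show ?thesis by simp
qed

section \<open>The polynomial ring and ideals generated by variables\<close>

lemma poly_ring_0: "0 \<in> poly_ring m"
  by (simp add: poly_ring_def)

lemma poly_ring_single:
  "Poly_Mapping.keys \<alpha> \<subseteq> {1..m} \<Longrightarrow> Poly_Mapping.single \<alpha> c \<in> poly_ring m"
  by (auto simp: poly_ring_def)

lemma poly_ring_add: "p \<in> poly_ring m \<Longrightarrow> q \<in> poly_ring m \<Longrightarrow> p + q \<in> poly_ring m"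
  using keys_add[of p q] unfolding poly_ring_def by blast

lemma poly_ring_uminus: "p \<in> poly_ring m \<Longrightarrow> - p \<in> poly_ring m"
  unfolding poly_ring_def by (auto simp: in_keys_iff)

lemma poly_ring_diff: "p \<in> poly_ring m \<Longrightarrow> q \<in> poly_ring m \<Longrightarrow> p - q \<in> poly_ring m"
  using poly_ring_add[of p m "- q"] poly_ring_uminus[of q m] by simp

lemma poly_ring_mult:
  assumes "p \<in> poly_ring m" "q \<in> poly_ring m"
  shows "p * q \<in> poly_ring m"
  unfolding poly_ring_def
proof safe
  fix \<gamma> i assume "\<gamma> \<in> Poly_Mapping.keys (p * q)" "i \<in> Poly_Mapping.keys \<gamma>"
  then obtain \<alpha> \<beta> where *: "\<alpha> \<in> Poly_Mapping.keys p" "\<beta> \<in> Poly_Mapping.keys q"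
    "i \<in> Poly_Mapping.keys (\<alpha> + \<beta>)"
    using keys_mult[of p q] by blast
  then have "i \<in> Poly_Mapping.keys \<alpha> \<union> Poly_Mapping.keys \<beta>" using keys_add[of \<alpha> \<beta>] by blast
  then show "i \<in> {1..m}" using * assms unfolding poly_ring_def by blast
qed

lemma poly_ring_sum: "(\<And>x. x \<in> A \<Longrightarrow> f x \<in> poly_ring m) \<Longrightarrow> sum f A \<in> poly_ring m"
  using keys_sum_subset[of f A] unfolding poly_ring_def by blast

lemma poly_ring_part: "p \<in> poly_ring m \<Longrightarrow> part P p \<in> poly_ring m"
  by (auto simp: poly_ring_def keys_part)

text \<open>The ideal generated by $x_1, \dots, x_i$ in the polynomials in all variables. It is a monomial
  ideal, so membership can be read off the exponents one by one.\<close>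

definition vars_ideal :: "nat \<Rightarrow> ('k::field) mpoly set" where
  "vars_ideal i = {p. \<forall>\<alpha>\<in>Poly_Mapping.keys p. \<exists>j\<in>{1..i}. Poly_Mapping.lookup \<alpha> j \<noteq> 0}"

lemma vars_ideal_0: "vars_ideal 0 = {0}"
  by (auto simp: vars_ideal_def)

lemma zero_in_vars_ideal: "0 \<in> vars_ideal i"
  by (simp add: vars_ideal_def)

lemma vars_ideal_add: "p \<in> vars_ideal i \<Longrightarrow> q \<in> vars_ideal i \<Longrightarrow> p + q \<in> vars_ideal i"
  using keys_add[of p q] unfolding vars_ideal_def by blast

lemma vars_ideal_uminus: "p \<in> vars_ideal i \<Longrightarrow> - p \<in> vars_ideal i"
  unfolding vars_ideal_def by (auto simp: in_keys_iff)

lemma vars_ideal_mult: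
  assumes "q \<in> vars_ideal i"
  shows "p * q \<in> vars_ideal i"
  unfolding vars_ideal_def
proof safe
  fix \<gamma> assume "\<gamma> \<in> Poly_Mapping.keys (p * q)"
  then obtain \<alpha> \<beta> where *: "\<gamma> = \<alpha> + \<beta>" "\<beta> \<in> Poly_Mapping.keys q"
    using keys_mult[of p q] by blast
  then show "\<exists>j\<in>{1..i}. Poly_Mapping.lookup \<gamma> j \<noteq> 0"
    using assms by (auto simp: vars_ideal_def lookup_add)
qed

lemma vars_ideal_sum: "(\<And>x. x \<in> A \<Longrightarrow> f x \<in> vars_ideal i) \<Longrightarrow> sum f A \<in> vars_ideal i"
  using keys_sum_subset[of f A] unfolding vars_ideal_def by blast

lemma vars_ideal_mono: "i \<le> i' \<Longrightarrow> vars_ideal i \<subseteq> vars_ideal i'"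
  unfolding vars_ideal_def by fastforce

definition Var :: "nat \<Rightarrow> ('k::field) mpoly" where
  "Var i = Poly_Mapping.single (Poly_Mapping.single i 1) 1"

lemma Var_in_poly_ring: "i \<in> {1..m} \<Longrightarrow> Var i \<in> poly_ring m"
  unfolding Var_def by (rule poly_ring_single) auto

lemma Var_in_vars_ideal: "i \<in> {1..i'} \<Longrightarrow> Var i \<in> vars_ideal i'"
  by (auto simp: Var_def vars_ideal_def lookup_single intro!: bexI[of _ i])

lemma divide_by_Var:
  assumes "p \<in> poly_ring m" "\<And>\<alpha>. \<alpha> \<in> Poly_Mapping.keys p \<Longrightarrow> Poly_Mapping.lookup \<alpha> i \<noteq> 0"
  shows "\<exists>u\<in>poly_ring m. p = Var i * u"
proof -
  let ?e = "Poly_Mapping.single i (1::nat)"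
  define u where "u = (\<Sum>\<alpha>\<in>Poly_Mapping.keys p. Poly_Mapping.single (\<alpha> - ?e) (Poly_Mapping.lookup p \<alpha>))"
  have "Poly_Mapping.single (\<alpha> - ?e) c \<in> poly_ring m" if "\<alpha> \<in> Poly_Mapping.keys p" for \<alpha> and c :: 'a
  proof (rule poly_ring_single)
    have "Poly_Mapping.keys (\<alpha> - ?e) \<subseteq> Poly_Mapping.keys \<alpha>"
      by (auto simp: in_keys_iff lookup_minus)
    then show "Poly_Mapping.keys (\<alpha> - ?e) \<subseteq> {1..m}" using assms(1) that by (auto simp: poly_ring_def)
  qed
  then have "u \<in> poly_ring m" unfolding u_def by (intro poly_ring_sum)
  moreover have "Var i * u = p"
  proof -
    have e: "?e + (\<alpha> - ?e) = \<alpha>" if "\<alpha> \<in> Poly_Mapping.keys p" for \<alpha>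
      using assms(2)[OF that]
      by (intro poly_mapping_eqI) (auto simp: lookup_add lookup_minus lookup_single when_def)
    have "Var i * u = (\<Sum>\<alpha>\<in>Poly_Mapping.keys p. Poly_Mapping.single \<alpha> (Poly_Mapping.lookup p \<alpha>))"
      unfolding u_def Var_def sum_distrib_left mult_single using e by (intro sum.cong) auto
    then show ?thesis by (simp add: sum_monomials)
  qed
  ultimately show ?thesis by metis
qed

text \<open>Collect the monomials of \<open>p\<close> free of $x_1, \dots, x_i$: each of them contains
  $x_{i+1}$, so their sum is $x_{i+1} u$.\<close>

lemma vars_ideal_Suc_split:
  assumes "p \<in> vars_ideal (Suc i)" "p \<in> poly_ring m"
  shows "\<exists>u\<in>poly_ring m. p - Var (Suc i) * u \<in> vars_ideal i"
proof -
  let ?P = "\<lambda>\<alpha>. \<exists>j\<in>{1..i}. Poly_Mapping.lookup \<alpha> j \<noteq> 0"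
  have "Poly_Mapping.lookup \<alpha> (Suc i) \<noteq> 0" if "\<alpha> \<in> Poly_Mapping.keys (part (\<lambda>\<alpha>. \<not> ?P \<alpha>) p)" for \<alpha>
    using that assms(1) by (auto simp: keys_part vars_ideal_def atLeastAtMostSuc_conv)
  then obtain u where u: "u \<in> poly_ring m" "part (\<lambda>\<alpha>. \<not> ?P \<alpha>) p = Var (Suc i) * u"
    using divide_by_Var[OF poly_ring_part[OF assms(2)]] by blast
  have "p - Var (Suc i) * u = part ?P p"
    using part_split[of p ?P] u(2) by (simp add: algebra_simps)
  also have "\<dots> \<in> vars_ideal i" by (auto simp: vars_ideal_def keys_part)
  finally show ?thesis using u(1) by blast
qed

text \<open>The variable $x_{i+1}$ is a nonzerodivisor modulo $(x_1, \dots, x_i)$: multiplication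
  by it does not touch the exponents of the first \<open>i\<close> variables, so the part of \<open>u\<close> free of these
  variables would survive in the product.\<close>

lemma Var_mult_cancel_vars_ideal:
  assumes "Var (Suc i) * u \<in> vars_ideal i"
  shows "u \<in> vars_ideal i"
proof -
  let ?P = "\<lambda>\<alpha>. \<exists>j\<in>{1..i}. Poly_Mapping.lookup \<alpha> j \<noteq> 0"
  have "part (\<lambda>\<alpha>. \<not> ?P \<alpha>) (Var (Suc i) * u) = Var (Suc i) * part (\<lambda>\<alpha>. \<not> ?P \<alpha>) u"
    by (rule part_mult) (auto simp: Var_def lookup_add lookup_single when_def split: if_splits)
  moreover have "part (\<lambda>\<alpha>. \<not> ?P \<alpha>) (Var (Suc i) * u) = 0"
    using assms by (intro part_eq_0) (auto simp: vars_ideal_def)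
  moreover have "Var (Suc i) \<noteq> (0 :: 'a mpoly)"
    by (simp add: Var_def flip: keys_eq_empty)
  ultimately have "part (\<lambda>\<alpha>. \<not> ?P \<alpha>) u = 0" by simp
  then have "u = part ?P u" using part_split[of u ?P] by simp
  then show ?thesis unfolding vars_ideal_def using keys_part[of ?P u] by auto
qed

section \<open>The homomorphism onto the semigroup ring\<close>

lemma wdeg_eq:
  assumes "finite A" "Poly_Mapping.keys \<alpha> \<subseteq> A"
  shows "wdeg d \<alpha> = (\<Sum>i\<in>A. Poly_Mapping.lookup \<alpha> i * d i)"
  unfolding wdeg_def using assms by (intro sum.mono_neutral_left) (auto simp: in_keys_iff)

lemma wdeg_add: "wdeg d (\<alpha> + \<beta>) = wdeg d \<alpha> + wdeg d \<beta>"
proof -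
  let ?A = "Poly_Mapping.keys \<alpha> \<union> Poly_Mapping.keys \<beta>"
  have "wdeg d (\<alpha> + \<beta>) = (\<Sum>i\<in>?A. Poly_Mapping.lookup (\<alpha> + \<beta>) i * d i)"
    using keys_add[of \<alpha> \<beta>] by (intro wdeg_eq) auto
  also have "\<dots> = wdeg d \<alpha> + wdeg d \<beta>"
    by (simp add: lookup_add distrib_right sum.distrib wdeg_eq[of ?A \<alpha>] wdeg_eq[of ?A \<beta>])
  finally show ?thesis .
qed

lemma wdeg_single: "wdeg d (Poly_Mapping.single i c) = c * d i"
  by (simp add: wdeg_def)

lemma wdeg_0: "wdeg d 0 = 0"
  by (simp add: wdeg_def)

lemma semigroup_hom_eq:
  assumes "finite A" "Poly_Mapping.keys p \<subseteq> A"
  shows "semigroup_hom d p = (\<Sum>\<alpha>\<in>A. monom (Poly_Mapping.lookup p \<alpha>) (wdeg d \<alpha>))"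
  unfolding semigroup_hom_def using assms by (intro sum.mono_neutral_left) (auto simp: in_keys_iff)

lemma semigroup_hom_add: "semigroup_hom d (p + q) = semigroup_hom d p + semigroup_hom d q"
proof -
  let ?A = "Poly_Mapping.keys p \<union> Poly_Mapping.keys q"
  have "semigroup_hom d (p + q) = (\<Sum>\<alpha>\<in>?A. monom (Poly_Mapping.lookup (p + q) \<alpha>) (wdeg d \<alpha>))"
    using keys_add[of p q] by (intro semigroup_hom_eq) auto
  also have "\<dots> = semigroup_hom d p + semigroup_hom d q"
    by (simp add: lookup_add sum.distrib add_monom[symmetric] semigroup_hom_eq[of ?A p] semigroup_hom_eq[of ?A q])
  finally show ?thesis .
qed

lemma semigroup_hom_0: "semigroup_hom d 0 = 0"
  by (simp add: semigroup_hom_def)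

lemma semigroup_hom_sum: "semigroup_hom d (sum f A) = (\<Sum>x\<in>A. semigroup_hom d (f x))"
  by (induction A rule: infinite_finite_induct) (simp_all add: semigroup_hom_0 semigroup_hom_add)

lemma semigroup_hom_single: "semigroup_hom d (Poly_Mapping.single \<alpha> c) = monom c (wdeg d \<alpha>)"
  by (simp add: semigroup_hom_def)

lemma semigroup_hom_single_mult:
  "semigroup_hom d (Poly_Mapping.single \<alpha> c * p) = monom c (wdeg d \<alpha>) * semigroup_hom d p"
proof -
  have "Poly_Mapping.single \<alpha> c * p =
     (\<Sum>\<beta>\<in>Poly_Mapping.keys p. Poly_Mapping.single (\<alpha> + \<beta>) (c * Poly_Mapping.lookup p \<beta>))"
    by (subst (1) sum_monomials[of p, symmetric]) (simp add: sum_distrib_left mult_single)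
  then have "semigroup_hom d (Poly_Mapping.single \<alpha> c * p) =
     (\<Sum>\<beta>\<in>Poly_Mapping.keys p. monom (c * Poly_Mapping.lookup p \<beta>) (wdeg d \<alpha> + wdeg d \<beta>))"
    by (simp add: semigroup_hom_sum semigroup_hom_single wdeg_add)
  also have "\<dots> = monom c (wdeg d \<alpha>) * semigroup_hom d p"
    by (simp add: semigroup_hom_def sum_distrib_left mult_monom)
  finally show ?thesis .
qed

lemma semigroup_hom_Var_mult: "semigroup_hom d (Var i * u) = monom 1 (d i) * semigroup_hom d u"
  by (simp add: Var_def semigroup_hom_single_mult wdeg_single)

section \<open>Rank and nullity on finite-dimensional subspaces\<close>

text \<open>The ambient spaces below are infinite-dimensional, hence this form for a finitely spanned
  subspace \<open>V\<close>. A basis of the kernel is extended to a basis of \<open>V\<close>; the added vectors are mapped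
  injectively onto a basis of the image, because a vector in both spans has two representations
  with disjoint supports.\<close>

lemma (in vector_space_pair) dim_kernel_plus_dim_image:
  assumes f: "Vector_Spaces.linear s1 s2 f" and V: "vs1.subspace V" "V \<subseteq> vs1.span W" "finite W"
  shows "vs1.dim V = vs1.dim {v \<in> V. f v = 0} + vs2.dim (f ` V)"
proof -
  let ?K = "{v \<in> V. f v = 0}"
  obtain B0 where B0: "B0 \<subseteq> ?K" "vs1.independent B0" "?K \<subseteq> vs1.span B0" "card B0 = vs1.dim ?K"
    using vs1.basis_exists[of ?K] by blast
  obtain B where B: "B0 \<subseteq> B" "B \<subseteq> V" "vs1.independent B" "V \<subseteq> vs1.span B"
    using vs1.maximal_independent_subset_extend[of B0 V] B0 by blast
  have fin: "finite B"
    using vs1.independent_span_bound[OF V(3) B(3)] B(2) V(2) by blast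
  have in_V: "vs1.span X \<subseteq> V" if "X \<subseteq> B" for X
    using that B(2) V(1) by (intro vs1.span_minimal) auto
  let ?B' = "B - B0"
  have ind': "vs1.independent ?B'"
    by (rule vs1.independent_mono[OF B(3)]) auto
  have inj: "inj_on f (vs1.span ?B')"
  proof (subst linear_inj_on_iff_eq_0[OF f vs1.subspace_span], intro ballI impI)
    fix x assume x: "x \<in> vs1.span ?B'" "f x = 0"
    then have "x \<in> vs1.span B0" using in_V[of ?B'] B0(3) by auto
    then have "vs1.representation B x = vs1.representation B0 x"
      using vs1.representation_extend[OF B(3)] B(1) by blast
    moreover have "vs1.representation B x = vs1.representation ?B' x"
      using vs1.representation_extend[OF B(3)] x(1) by blast
    ultimately have "vs1.representation ?B' x y = 0" for y
      using vs1.representation_ne_zero[of B0 x y] vs1.representation_ne_zero[of ?B' x y] by fastforce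
    then show "x = 0"
      using vs1.sum_nonzero_representation_eq[OF ind' x(1)] by simp
  qed
  have "vs2.dim (f ` V) = card (f ` ?B')"
  proof (rule vs2.dim_unique[symmetric, OF _ _ _ refl, THEN sym])
    show "f ` ?B' \<subseteq> f ` V" using B(2) by auto
    show "vs2.independent (f ` ?B')"
      by (rule linear_independent_injective_image[OF f ind' inj])
    show "f ` V \<subseteq> vs2.span (f ` ?B')"
    proof -
      have "f ` V \<subseteq> vs2.span (f ` B)"
        using B(4) linear_span_image[OF f, of B] by auto
      also have "\<dots> \<subseteq> vs2.span (f ` ?B')"
      proof (rule vs2.span_minimal)
        show "f ` B \<subseteq> vs2.span (f ` ?B')"
        proof safe
          fix y assume "y \<in> B"
          show "f y \<in> vs2.span (f ` ?B')"
          proof (cases "y \<in> B0")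
            case True
            then show ?thesis using B0(1) vs2.span_zero by auto
          next
            case False
            then show ?thesis using \<open>y \<in> B\<close> by (intro vs2.span_base) auto
          qed
        qed
      qed (rule vs2.subspace_span)
      finally show ?thesis .
    qed
  qed
  also have "\<dots> = card ?B'"
    using inj by (intro card_image) (meson inj_on_subset vs1.span_superset)
  finally have "vs2.dim (f ` V) = card ?B'" .
  moreover have "vs1.dim V = card B"
    using vs1.basis_card_eq_dim[OF B(2) B(4) B(3)] by simp
  moreover have "card B = card B0 + card ?B'"
    using fin B(1) by (metis card_Diff_subset card_mono finite_subset le_add_diff_inverse)
  ultimately show ?thesis using B0(4) by simp
qed

text \<open>Vectors of polynomials form a vector space over the coefficient field, with pointwise
  operations; scalars act as constant polynomials.\<close>

definition scalar_mult :: "'k::field \<Rightarrow> ('j \<Rightarrow> 'k mpoly) \<Rightarrow> 'j \<Rightarrow> 'k mpoly" where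
  "scalar_mult c v = (\<lambda>j. Poly_Mapping.single 0 c * v j)"

lemma lookup_scalar_mult:
  "Poly_Mapping.lookup (scalar_mult c v j) \<alpha> = c * Poly_Mapping.lookup (v j) \<alpha>"
proof -
  have "scalar_mult c v j = Poly_Mapping.map ((*) c) (v j)"
    by (simp add: scalar_mult_def mult_map_scale_conv_mult)
  then show ?thesis by (simp add: Poly_Mapping.map.rep_eq when_def)
qed

lemma vector_space_scalar_mult: "vector_space (scalar_mult :: 'k::field \<Rightarrow> ('j \<Rightarrow> 'k mpoly) \<Rightarrow> _)"
  by unfold_locales (auto simp: scalar_mult_def fun_eq_iff distrib_left distrib_right single_add mult_single
      mult.assoc[symmetric])

lemma vector_space_smult: "vector_space (smult :: 'k::field \<Rightarrow> 'k poly \<Rightarrow> 'k poly)"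
  by unfold_locales (auto simp: smult_add_right smult_add_left)

interpretation mvec: vector_space "scalar_mult :: 'k::field \<Rightarrow> (nat \<Rightarrow> 'k mpoly) \<Rightarrow> _"
  by (rule vector_space_scalar_mult)

interpretation upoly: vector_space "smult :: 'k::field \<Rightarrow> 'k poly \<Rightarrow> 'k poly"
  by (rule vector_space_smult)

interpretation mvec_mvec: vector_space_pair "scalar_mult :: 'k::field \<Rightarrow> (nat \<Rightarrow> 'k mpoly) \<Rightarrow> _"
   "scalar_mult :: 'k::field \<Rightarrow> (nat \<Rightarrow> 'k mpoly) \<Rightarrow> _" ..

interpretation mvec_upoly: vector_space_pair "scalar_mult :: 'k::field \<Rightarrow> (nat \<Rightarrow> 'k mpoly) \<Rightarrow> _"
   "smult :: 'k::field \<Rightarrow> 'k poly \<Rightarrow> 'k poly" ..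

section \<open>Free modules and the resolution\<close>

lemma free_moduleI:
  "(\<And>j. j \<in> {1..b} \<Longrightarrow> v j \<in> poly_ring m) \<Longrightarrow> (\<And>j. j \<notin> {1..b} \<Longrightarrow> v j = 0) \<Longrightarrow> v \<in> free_module m b"
  by (simp add: free_module_def)

lemma free_module_in_ring: "v \<in> free_module m b \<Longrightarrow> v j \<in> poly_ring m"
  unfolding free_module_def by (cases "j \<in> {1..b}") (auto simp: poly_ring_0)

lemma free_module_outside: "v \<in> free_module m b \<Longrightarrow> j \<notin> {1..b} \<Longrightarrow> v j = 0"
  unfolding free_module_def by blast

lemma free_module_0: "0 \<in> free_module m b"
  by (simp add: free_module_def poly_ring_0)

lemma free_module_add: "v \<in> free_module m b \<Longrightarrow> w \<in> free_module m b \<Longrightarrow> v + w \<in> free_module m b"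
  by (auto simp: free_module_def poly_ring_add)

lemma free_module_diff: "v \<in> free_module m b \<Longrightarrow> w \<in> free_module m b \<Longrightarrow> v - w \<in> free_module m b"
  by (auto simp: free_module_def poly_ring_diff)

lemma free_module_mult: "v \<in> free_module m b \<Longrightarrow> c \<in> poly_ring m \<Longrightarrow> (\<lambda>j. c * v j) \<in> free_module m b"
  by (auto simp: free_module_def poly_ring_mult)

lemma mat_map_add: "mat_map b' b A (v + w) = mat_map b' b A v + mat_map b' b A w"
  by (auto simp: mat_map_def fun_eq_iff distrib_left sum.distrib)

lemma mat_map_diff: "mat_map b' b A (v - w) = mat_map b' b A v - mat_map b' b A w"
  by (auto simp: mat_map_def fun_eq_iff right_diff_distrib sum_subtractf)

lemma mat_map_mult: "mat_map b' b A (\<lambda>j. c * v j) = (\<lambda>j. c * mat_map b' b A v j)"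
  by (auto simp: mat_map_def fun_eq_iff sum_distrib_left mult.left_commute)

lemma mat_map_vars_ideal:
  "(\<And>j. v j \<in> vars_ideal i) \<Longrightarrow> mat_map b' b A v a \<in> vars_ideal i"
  by (auto simp: mat_map_def zero_in_vars_ideal intro!: vars_ideal_sum vars_ideal_mult)

lemma linear_mat_map: "Vector_Spaces.linear scalar_mult scalar_mult (mat_map b' b A)"
  unfolding Vector_Spaces.linear_iff
  using mat_map_add mat_map_mult vector_space_scalar_mult by (auto simp: scalar_mult_def)

locale numerical_resolution =
  fixes m :: nat and d :: "nat \<Rightarrow> nat" and b :: "nat \<Rightarrow> nat" and E :: "nat \<Rightarrow> nat \<Rightarrow> nat"
    and M :: "nat \<Rightarrow> nat \<Rightarrow> nat \<Rightarrow> ('k::field) mpoly"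
  assumes m_pos: "1 \<le> m"
    and d_pos: "i \<in> {1..m} \<Longrightarrow> 0 < d i"
    and resolution: "minimal_free_resolution m d b E M"
begin

abbreviation F :: "nat \<Rightarrow> (nat \<Rightarrow> 'k mpoly) set" where
  "F k \<equiv> free_module m (b k)"

abbreviation D :: "nat \<Rightarrow> (nat \<Rightarrow> 'k mpoly) \<Rightarrow> nat \<Rightarrow> 'k mpoly" where
  "D k \<equiv> mat_map (b (k - 1)) (b k) (M k)"

text \<open>The map out of $F_0$ is the augmentation onto the semigroup ring. Treating it as the
  differential in degree 0 makes exactness a single statement for all \<open>k\<close>.\<close>

definition cycle :: "nat \<Rightarrow> (nat \<Rightarrow> 'k mpoly) \<Rightarrow> bool" where
  "cycle k v \<longleftrightarrow> (if k = 0 then semigroup_hom d (v 1) = 0 else D k v = 0)"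

lemma b_0: "b 0 = 1" and E_0: "E 1 0 = 0"
  using resolution by (auto simp: minimal_free_resolution_def)

lemma entries:
  assumes "1 \<le> k" "a \<in> {1..b (k - 1)}" "j \<in> {1..b k}"
  shows entry_in_ring: "M k a j \<in> poly_ring m"
    and entry_degree: "\<alpha> \<in> Poly_Mapping.keys (M k a j) \<Longrightarrow> E a (k - 1) + wdeg d \<alpha> = E j k"
    and entry_minimal: "Poly_Mapping.lookup (M k a j) 0 = 0"
  using resolution assms by (auto simp: minimal_free_resolution_def)

lemma exactness: "{v \<in> F k. cycle k v} = D (k + 1) ` F (k + 1)"
proof (cases "k = 0")
  case True
  have "{v \<in> F 0. semigroup_hom d (v 1) = 0} = mat_map (b 0) (b 1) (M 1) ` F 1"
    using resolution unfolding minimal_free_resolution_def by blast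
  then show ?thesis using True by (simp add: cycle_def)
next
  case False
  then have "{v \<in> F k. D k v = (\<lambda>_. 0)} = mat_map (b k) (b (k + 1)) (M (k + 1)) ` F (k + 1)"
    using resolution unfolding minimal_free_resolution_def by auto
  then show ?thesis using False by (simp add: cycle_def zero_fun_def)
qed

lemma D_in_F: "w \<in> F (k + 1) \<Longrightarrow> D (k + 1) w \<in> F k"
  using exactness[of k] by blast

lemma cycle_D: "w \<in> F (k + 1) \<Longrightarrow> cycle k (D (k + 1) w)"
  using exactness[of k] by blast

lemma cycle_imp_boundary:
  assumes "v \<in> F k" "cycle k v"
  shows "\<exists>w\<in>F (k + 1). D (k + 1) w = v"
proof -
  have "v \<in> D (k + 1) ` F (k + 1)"
    unfolding exactness[symmetric] using assms by simp
  then show ?thesis by (metis imageE)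
qed

text \<open>The resolution stays exact at $F_k$ modulo $x_1, \dots, x_i$ as long as $k \ge i$ and
  $k \ge 1$: each further variable costs one degree of exactness, except $x_1$, which is free of
  charge because it acts injectively on the semigroup ring, a subring of $k[t]$. This is the long
  exact sequence for multiplication by $x_{i+1}$, written out. If $D v = x_{i+1} u$ modulo
  $(x_1, \dots, x_i)$, then \<open>u\<close> is a cycle modulo that ideal, hence a boundary \<open>D w\<close>; so
  $v - x_{i+1} w$ is a cycle modulo $(x_1, \dots, x_i)$ and therefore a boundary.\<close>

lemma exact_modulo_variables:
  assumes "i \<le> m" "1 \<le> k" "i \<le> k" "v \<in> F k" "\<And>a. D k v a \<in> vars_ideal i"
  shows "\<exists>w\<in>F (k + 1). \<forall>j. v j - D (k + 1) w j \<in> vars_ideal i"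
  using assms
proof (induction i arbitrary: k v)
  case 0
  then have "D k v = 0" by (simp add: vars_ideal_0 fun_eq_iff)
  then obtain w where "w \<in> F (k + 1)" "D (k + 1) w = v"
    using cycle_imp_boundary[of v k] 0 by (auto simp: cycle_def)
  then show ?case by (intro bexI[of _ w]) (auto simp: zero_in_vars_ideal)
next
  case (Suc i)
  let ?x = "Var (Suc i) :: 'k mpoly"
  obtain l where l: "k = l + 1" using Suc.prems(2) by (metis Suc_eq_plus1 Suc_le_D One_nat_def)
  have x: "?x \<in> poly_ring m" using Suc.prems(1) by (intro Var_in_poly_ring) auto
  have "\<exists>u\<in>poly_ring m. D k v a - ?x * u \<in> vars_ideal i \<and> (a \<notin> {1..b l} \<longrightarrow> u = 0)" for a
  proof (cases "a \<in> {1..b l}")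
    case True
    have "D k v \<in> F l" using D_in_F[of v l] Suc.prems(4) l by simp
    then have "D k v a \<in> poly_ring m" by (rule free_module_in_ring)
    then show ?thesis
      using vars_ideal_Suc_split[OF Suc.prems(5)] True by blast
  next
    case False
    then show ?thesis using l
      by (intro bexI[of _ 0]) (auto simp: mat_map_def poly_ring_0 zero_in_vars_ideal)
  qed
  then obtain u where u: "\<And>a. u a \<in> poly_ring m" "\<And>a. D k v a - ?x * u a \<in> vars_ideal i"
    "\<And>a. a \<notin> {1..b l} \<Longrightarrow> u a = 0"
    by metis
  then have uF: "u \<in> F l" by (intro free_moduleI) auto
  \<comment> \<open>\<open>u\<close> is a boundary modulo the first \<open>i\<close> variables; in degree 0 this uses the augmentation
    instead of the induction hypothesis, and \<open>i = 0\<close> is then forced.\<close>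
  have "\<exists>w\<in>F (l + 1). \<forall>a. u a - D (l + 1) w a \<in> vars_ideal i"
  proof (cases "l = 0")
    case True
    then have i: "i = 0" using Suc.prems(3) l by simp
    have "D k v 1 = ?x * u 1" using u(2)[of 1] i by (simp add: vars_ideal_0)
    moreover have "semigroup_hom d (D k v 1) = 0"
      using cycle_D[of v 0] Suc.prems(4) l True by (simp add: cycle_def)
    ultimately have "semigroup_hom d (u 1) = 0"
      by (simp add: semigroup_hom_Var_mult)
    then obtain w where "w \<in> F (l + 1)" "D (l + 1) w = u"
      using cycle_imp_boundary[OF uF] True by (auto simp: cycle_def)
    then show ?thesis by (intro bexI[of _ w]) (auto simp: zero_in_vars_ideal)
  next
    case False
    have "D l u a \<in> vars_ideal i" for a
    proof -
      have "D l (D k v) = 0"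
        using cycle_D[of v l] Suc.prems(4) l False by (simp add: cycle_def)
      then have "?x * D l u a = - D l (\<lambda>a. D k v a - ?x * u a) a"
        using mat_map_diff[of "b (l - 1)" "b l" "M l" "D k v" "\<lambda>a. ?x * u a"]
        by (simp add: mat_map_mult fun_diff_def fun_eq_iff)
      moreover have "D l (\<lambda>a. D k v a - ?x * u a) a \<in> vars_ideal i"
        using u(2) by (rule mat_map_vars_ideal)
      ultimately have "?x * D l u a \<in> vars_ideal i"
        by (simp add: vars_ideal_uminus)
      then show ?thesis by (rule Var_mult_cancel_vars_ideal)
    qed
    then show ?thesis
      using Suc.IH[of l u] Suc.prems(1,3) l False uF by auto
  qed
  then obtain w where w: "w \<in> F k" "\<And>a. u a - D k w a \<in> vars_ideal i" using l by auto
  define v' where "v' = v - (\<lambda>j. ?x * w j)"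
  have "D k v' a = (D k v a - ?x * u a) + ?x * (u a - D k w a)" for a
    by (simp add: v'_def mat_map_diff mat_map_mult right_diff_distrib)
  then have "D k v' a \<in> vars_ideal i" for a
    using u(2) w(2) by (simp add: vars_ideal_add vars_ideal_mult)
  moreover have "v' \<in> F k"
    unfolding v'_def using Suc.prems(4) w(1) x by (intro free_module_diff free_module_mult) auto
  ultimately have "\<exists>w'\<in>F (k + 1). \<forall>j. v' j - D (k + 1) w' j \<in> vars_ideal i"
    using Suc.prems(1-3) by (intro Suc.IH) auto
  then obtain w' where w': "w' \<in> F (k + 1)" "\<And>j. v' j - D (k + 1) w' j \<in> vars_ideal i"
    by blast
  have "v j - D (k + 1) w' j \<in> vars_ideal (Suc i)" for j
  proof -
    have "v j - D (k + 1) w' j = (v' j - D (k + 1) w' j) + w j * ?x" by (simp add: v'_def mult.commute)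
    moreover have "v' j - D (k + 1) w' j \<in> vars_ideal (Suc i)"
      using w'(2) vars_ideal_mono[of i "Suc i"] by auto
    moreover have "w j * ?x \<in> vars_ideal (Suc i)"
      by (intro vars_ideal_mult Var_in_vars_ideal) auto
    ultimately show ?thesis using vars_ideal_add by metis
  qed
  then show ?case using w'(1) by auto
qed

lemma entry_in_vars_ideal:
  assumes "1 \<le> k" "a \<in> {1..b (k - 1)}" "j \<in> {1..b k}"
  shows "M k a j \<in> vars_ideal m"
  unfolding vars_ideal_def
proof safe
  fix \<alpha> assume \<alpha>: "\<alpha> \<in> Poly_Mapping.keys (M k a j)"
  then have "\<alpha> \<noteq> 0" using entry_minimal[OF assms] by (auto simp: in_keys_iff)
  then obtain i where i: "Poly_Mapping.lookup \<alpha> i \<noteq> 0"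
    by (metis lookup_zero poly_mapping_eqI)
  then have "i \<in> Poly_Mapping.keys \<alpha>" by (simp add: in_keys_iff)
  then have "i \<in> {1..m}"
    using entry_in_ring[OF assms] \<alpha> unfolding poly_ring_def by blast
  then show "\<exists>j\<in>{1..m}. Poly_Mapping.lookup \<alpha> j \<noteq> 0" using i by blast
qed

lemma D_in_vars_ideal:
  assumes "1 \<le> k" "w \<in> F k"
  shows "D k w a \<in> vars_ideal m"
proof (cases "a \<in> {1..b (k - 1)}")
  case True
  have "w j * M k a j \<in> vars_ideal m" if "j \<in> {1..b k}" for j
    using entry_in_vars_ideal[OF assms(1) True that] by (rule vars_ideal_mult)
  then show ?thesis
    using True by (auto simp: mat_map_def mult.commute intro!: vars_ideal_sum)
qed (auto simp: mat_map_def zero_in_vars_ideal)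

text \<open>The resolution has length at most $m - 1$. Modulo all variables the differentials vanish by
  minimality, so exactness at $F_k$ says that every basis vector of $F_k$ vanishes modulo the
  variables, that is, that there is none.\<close>

theorem Betti_number_eq_0:
  assumes "m \<le> k"
  shows "b k = 0"
proof (rule ccontr)
  assume "b k \<noteq> 0"
  define v :: "nat \<Rightarrow> 'k mpoly" where "v = (\<lambda>j. if j = 1 then 1 else 0)"
  have k: "1 \<le> k" using assms m_pos by simp
  have "(1 :: 'k mpoly) \<in> poly_ring m" by (simp add: poly_ring_def)
  then have v: "v \<in> F k" using \<open>b k \<noteq> 0\<close> by (intro free_moduleI) (auto simp: v_def poly_ring_0)
  then obtain w where w: "w \<in> F (k + 1)" "\<And>j. v j - D (k + 1) w j \<in> vars_ideal m"
    using exact_modulo_variables[of m k v] D_in_vars_ideal[OF k v] assms k by blast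
  have "D (k + 1) w 1 \<in> vars_ideal m" using D_in_vars_ideal[of "k + 1" w] w(1) by simp
  then have "v 1 \<in> vars_ideal m" using vars_ideal_add[OF w(2)[of 1]] by fastforce
  then show False by (simp add: v_def vars_ideal_def)
qed

end

section \<open>Counting monomials of given degree\<close>

definition exponents :: "nat \<Rightarrow> (nat \<Rightarrow> nat) \<Rightarrow> nat \<Rightarrow> (nat \<Rightarrow>\<^sub>0 nat) set" where
  "exponents m d t = {\<alpha>. Poly_Mapping.keys \<alpha> \<subseteq> {1..m} \<and> wdeg d \<alpha> = t}"

lemma exponents_0: "exponents 0 d t = (if t = 0 then {0} else {})"
  by (auto simp: exponents_def wdeg_0)

text \<open>A monomial either avoids the last variable or is that variable times a monomial of smaller
  degree. Finiteness and the generating function both follow from this recursion.\<close>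

lemma exponents_Suc:
  "exponents (Suc m) d t = exponents m d t \<union>
     (if d (Suc m) \<le> t
      then (+) (Poly_Mapping.single (Suc m) 1) ` exponents (Suc m) d (t - d (Suc m)) else {})"
  (is "?L = ?A \<union> ?B")
proof
  let ?e = "Poly_Mapping.single (Suc m) (1::nat)"
  show "?L \<subseteq> ?A \<union> ?B"
  proof
    fix \<alpha> assume \<alpha>: "\<alpha> \<in> ?L"
    then have keys: "Poly_Mapping.keys \<alpha> \<subseteq> insert (Suc m) {1..m}" and deg: "wdeg d \<alpha> = t"
      by (auto simp: exponents_def)
    show "\<alpha> \<in> ?A \<union> ?B"
    proof (cases "Poly_Mapping.lookup \<alpha> (Suc m) = 0")
      case True
      then have "Suc m \<notin> Poly_Mapping.keys \<alpha>" by (simp add: in_keys_iff)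
      then show ?thesis using keys deg unfolding exponents_def by blast
    next
      case False
      then have split: "\<alpha> = ?e + (\<alpha> - ?e)"
        by (intro poly_mapping_eqI) (auto simp: lookup_add lookup_minus lookup_single when_def)
      have "t = d (Suc m) + wdeg d (\<alpha> - ?e)"
        using deg wdeg_add[of d ?e "\<alpha> - ?e"] split by (simp add: wdeg_single)
      moreover have "Poly_Mapping.keys (\<alpha> - ?e) \<subseteq> Poly_Mapping.keys \<alpha>"
        by (auto simp: in_keys_iff lookup_minus)
      then have "Poly_Mapping.keys (\<alpha> - ?e) \<subseteq> {1..Suc m}" using \<alpha> by (auto simp: exponents_def)
      ultimately have "d (Suc m) \<le> t" "\<alpha> - ?e \<in> exponents (Suc m) d (t - d (Suc m))"
        by (auto simp: exponents_def)
      then show ?thesis using split by auto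
    qed
  qed
  show "?A \<union> ?B \<subseteq> ?L"
  proof -
    have "?A \<subseteq> ?L" by (auto simp: exponents_def)
    moreover have "?e + \<alpha> \<in> ?L" if "\<alpha> \<in> exponents (Suc m) d (t - d (Suc m))" "d (Suc m) \<le> t" for \<alpha>
      using that keys_add[of ?e \<alpha>] by (auto simp: exponents_def wdeg_add wdeg_single)
    ultimately show ?thesis by auto
  qed
qed

lemma finite_exponents:
  assumes "\<And>i. i \<in> {1..m} \<Longrightarrow> 0 < d i"
  shows "finite (exponents m d t)"
  using assms
proof (induction m arbitrary: t)
  case 0
  then show ?case by (simp add: exponents_0)
next
  case (Suc m)
  then have pos: "0 < d (Suc m)" by simp
  show ?case
  proof (induction t rule: less_induct)
    case (less t)
    have "finite (exponents m d t)" using Suc by simp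
    moreover have "finite (exponents (Suc m) d (t - d (Suc m)))" if "d (Suc m) \<le> t"
      using that pos by (intro less) auto
    ultimately show ?case by (subst exponents_Suc) auto
  qed
qed

lemma card_exponents_Suc:
  assumes "\<And>i. i \<in> {1..Suc m} \<Longrightarrow> 0 < d i"
  shows "card (exponents (Suc m) d t) = card (exponents m d t) +
     (if d (Suc m) \<le> t then card (exponents (Suc m) d (t - d (Suc m))) else 0)"
proof (cases "d (Suc m) \<le> t")
  case False
  then show ?thesis by (subst exponents_Suc) simp
next
  case True
  let ?B = "(+) (Poly_Mapping.single (Suc m) 1) ` exponents (Suc m) d (t - d (Suc m))"
  have "exponents m d t \<inter> ?B = {}"
    by (fastforce simp: exponents_def in_keys_iff lookup_add)
  moreover have "finite (exponents m d t)" "finite ?B"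
    using assms by (auto intro!: finite_exponents)
  moreover have "card ?B = card (exponents (Suc m) d (t - d (Suc m)))"
    by (intro card_image) (simp add: inj_on_def)
  ultimately show ?thesis
    using True by (subst exponents_Suc) (simp add: card_Un_disjoint)
qed

definition monomial_count_fps :: "nat \<Rightarrow> (nat \<Rightarrow> nat) \<Rightarrow> 'a::comm_ring_1 fps" where
  "monomial_count_fps m d = Abs_fps (\<lambda>t. of_nat (card (exponents m d t)))"

text \<open>The Hilbert series of the polynomial ring is $\prod_i 1/(1 - z^{d_i})$.\<close>

lemma monomial_count_fps_mult:
  assumes "\<And>i. i \<in> {1..m} \<Longrightarrow> 0 < d i"
  shows "monomial_count_fps m d * (\<Prod>i=1..m. 1 - fps_X ^ d i) = (1 :: 'a::comm_ring_1 fps)"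
  using assms
proof (induction m)
  case 0
  show ?case by (rule fps_ext) (simp add: monomial_count_fps_def exponents_0)
next
  case (Suc m)
  have "monomial_count_fps (Suc m) d * (1 - fps_X ^ d (Suc m)) = (monomial_count_fps m d :: 'a fps)"
  proof (rule fps_ext)
    fix t
    show "fps_nth (monomial_count_fps (Suc m) d * (1 - fps_X ^ d (Suc m)) :: 'a fps) t =
        fps_nth (monomial_count_fps m d) t"
      using card_exponents_Suc[of m d t] Suc.prems
      by (simp add: monomial_count_fps_def right_diff_distrib fps_X_power_mult_right_nth)
  qed
  then have "monomial_count_fps (Suc m) d * (\<Prod>i=1..Suc m. 1 - fps_X ^ d i) =
      (monomial_count_fps m d :: 'a fps) * (\<Prod>i=1..m. 1 - fps_X ^ d i)"
    by (simp add: prod.nat_ivl_Suc' mult_ac flip: mult.assoc)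
  then show ?case using Suc by simp
qed

lemma gen_semigroup_iff_exponents: "s \<in> gen_semigroup m d \<longleftrightarrow> exponents m d s \<noteq> {}"
proof
  assume "s \<in> gen_semigroup m d"
  then obtain x where x: "s = (\<Sum>i=1..m. x i * d i)" by (auto simp: gen_semigroup_def)
  define \<alpha> where "\<alpha> = (\<Sum>i=1..m. Poly_Mapping.single i (x i))"
  have lookup: "Poly_Mapping.lookup \<alpha> i = (if i \<in> {1..m} then x i else 0)" for i
    by (simp add: \<alpha>_def lookup_sum lookup_single when_def sum.delta)
  then have keys: "Poly_Mapping.keys \<alpha> \<subseteq> {1..m}"
    by (auto simp: in_keys_iff split: if_splits)
  moreover have "wdeg d \<alpha> = s"
    using wdeg_eq[OF _ keys, of d] by (simp add: lookup x)
  ultimately show "exponents m d s \<noteq> {}" by (auto simp: exponents_def)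
next
  assume "exponents m d s \<noteq> {}"
  then obtain \<alpha> where \<alpha>: "Poly_Mapping.keys \<alpha> \<subseteq> {1..m}" "wdeg d \<alpha> = s"
    by (auto simp: exponents_def)
  have "s = (\<Sum>i=1..m. Poly_Mapping.lookup \<alpha> i * d i)"
    using wdeg_eq[OF _ \<alpha>(1), of d] \<alpha>(2) by simp
  then show "s \<in> gen_semigroup m d" unfolding gen_semigroup_def by blast
qed

section \<open>Graded pieces of the resolution\<close>

context numerical_resolution
begin

text \<open>The homogeneous part of degree \<open>s\<close> of $F_k$, whose \<open>j\<close>-th generator has degree \<open>E j k\<close>.\<close>

definition piece :: "nat \<Rightarrow> nat \<Rightarrow> (nat \<Rightarrow> 'k mpoly) set" where
  "piece k s = {v \<in> F k. \<forall>j. \<forall>\<alpha>\<in>Poly_Mapping.keys (v j). E j k + wdeg d \<alpha> = s}"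

definition piece_exponents :: "nat \<Rightarrow> nat \<Rightarrow> nat \<Rightarrow> (nat \<Rightarrow>\<^sub>0 nat) set" where
  "piece_exponents k s j = {\<alpha>. Poly_Mapping.keys \<alpha> \<subseteq> {1..m} \<and> E j k + wdeg d \<alpha> = s}"

definition monomial_vector :: "nat \<Rightarrow> (nat \<Rightarrow>\<^sub>0 nat) \<Rightarrow> nat \<Rightarrow> 'k mpoly" where
  "monomial_vector j \<alpha> = (\<lambda>i. if i = j then Poly_Mapping.single \<alpha> 1 else 0)"

definition piece_basis :: "nat \<Rightarrow> nat \<Rightarrow> (nat \<Rightarrow> 'k mpoly) set" where
  "piece_basis k s = (\<lambda>(j, \<alpha>). monomial_vector j \<alpha>) ` (SIGMA j:{1..b k}. piece_exponents k s j)"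

lemma piece_exponents_eq:
  "piece_exponents k s j = (if E j k \<le> s then exponents m d (s - E j k) else {})"
  by (auto simp: piece_exponents_def exponents_def)

lemma finite_piece_exponents: "finite (piece_exponents k s j)"
  using finite_exponents[of m d] d_pos by (simp add: piece_exponents_eq)

lemma finite_piece_basis: "finite (piece_basis k s)"
  unfolding piece_basis_def by (intro finite_imageI finite_SigmaI finite_piece_exponents) auto

lemma inj_monomial_vector: "inj (\<lambda>(j, \<alpha>). monomial_vector j \<alpha>)"
proof (rule injI, clarify)
  fix j \<alpha> j' \<alpha>' assume eq: "monomial_vector j \<alpha> = monomial_vector j' \<alpha>'"
  have "Poly_Mapping.lookup (monomial_vector j' \<alpha>' j) \<alpha> = 1"
    unfolding eq[symmetric] by (simp add: monomial_vector_def)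
  then show "j = j' \<and> \<alpha> = \<alpha>'"
    by (auto simp: monomial_vector_def lookup_single when_def split: if_splits)
qed

lemma piece_subspace: "mvec.subspace (piece k s)"
proof (rule mvec.subspaceI)
  show "0 \<in> piece k s" by (simp add: piece_def free_module_0)
next
  fix v w assume vw: "v \<in> piece k s" "w \<in> piece k s"
  have "E j k + wdeg d \<alpha> = s" if "\<alpha> \<in> Poly_Mapping.keys ((v + w) j)" for j \<alpha>
  proof -
    have "\<alpha> \<in> Poly_Mapping.keys (v j) \<union> Poly_Mapping.keys (w j)"
      using that keys_add[of "v j" "w j"] by auto
    then show ?thesis using vw by (auto simp: piece_def)
  qed
  then show "v + w \<in> piece k s" using vw by (simp add: piece_def free_module_add)
next
  fix c v assume v: "v \<in> piece k s"
  have "scalar_mult c v \<in> F k"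
    unfolding scalar_mult_def using v
    by (intro free_module_mult poly_ring_single) (auto simp: piece_def)
  then show "scalar_mult c v \<in> piece k s"
    using v by (auto simp: piece_def in_keys_iff lookup_scalar_mult)
qed

lemma piece_basis_subset: "piece_basis k s \<subseteq> piece k s"
proof -
  have "monomial_vector j \<alpha> \<in> piece k s" if "j \<in> {1..b k}" "\<alpha> \<in> piece_exponents k s j" for j \<alpha>
  proof -
    have "Poly_Mapping.single \<alpha> 1 \<in> (poly_ring m :: 'k mpoly set)"
      using that(2) by (intro poly_ring_single) (simp add: piece_exponents_def)
    then show ?thesis
      using that by (auto simp: piece_def monomial_vector_def piece_exponents_def poly_ring_0
          intro!: free_moduleI split: if_splits)
  qed
  then show ?thesis by (auto simp: piece_basis_def)
qed

lemma piece_subset_span: "piece k s \<subseteq> mvec.span (piece_basis k s)"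
proof
  fix v assume v: "v \<in> piece k s"
  let ?t = "\<lambda>j \<alpha>. scalar_mult (Poly_Mapping.lookup (v j) \<alpha>) (monomial_vector j \<alpha>)"
  have "v = (\<Sum>j=1..b k. \<Sum>\<alpha>\<in>Poly_Mapping.keys (v j). ?t j \<alpha>)" (is "_ = ?S")
  proof
    fix i
    have fun_sum: "(\<Sum>x\<in>A. f x) i = (\<Sum>x\<in>A. f x i)" for A :: "'x set" and f :: "'x \<Rightarrow> nat \<Rightarrow> 'k mpoly"
      by (induction A rule: infinite_finite_induct) auto
    have "?S i = (\<Sum>j=1..b k. \<Sum>\<alpha>\<in>Poly_Mapping.keys (v j). ?t j \<alpha> i)"
      by (simp add: fun_sum)
    also have "\<dots> = (\<Sum>j=1..b k. if j = i then v i else 0)"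
    proof (rule sum.cong[OF refl])
      fix j
      show "(\<Sum>\<alpha>\<in>Poly_Mapping.keys (v j). ?t j \<alpha> i) = (if j = i then v i else 0)"
        by (auto simp: scalar_mult_def monomial_vector_def mult_single sum_monomials)
    qed
    also have "\<dots> = (if i \<in> {1..b k} then v i else 0)" by (simp add: sum.delta)
    also have "\<dots> = v i" using v free_module_outside[of v m "b k" i] by (auto simp: piece_def)
    finally show "v i = ?S i" ..
  qed
  also have "?S \<in> mvec.span (piece_basis k s)"
  proof (intro mvec.span_sum mvec.span_scale mvec.span_base)
    fix j \<alpha> assume j: "j \<in> {1..b k}" and \<alpha>: "\<alpha> \<in> Poly_Mapping.keys (v j)"
    have "v j \<in> poly_ring m" using v free_module_in_ring by (auto simp: piece_def)
    then have "\<alpha> \<in> piece_exponents k s j"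
      using v \<alpha> by (auto simp: piece_exponents_def piece_def poly_ring_def)
    then show "monomial_vector j \<alpha> \<in> piece_basis k s" using j by (force simp: piece_basis_def)
  qed
  finally show "v \<in> mvec.span (piece_basis k s)" .
qed

text \<open>Each basis vector has a coefficient at which all other basis vectors vanish.\<close>

lemma piece_basis_independent: "mvec.independent (piece_basis k s)"
proof
  assume "mvec.dependent (piece_basis k s)"
  then obtain v where v: "v \<in> piece_basis k s" "v \<in> mvec.span (piece_basis k s - {v})"
    unfolding mvec.dependent_def by blast
  then obtain j \<alpha> where ja: "v = monomial_vector j \<alpha>" by (auto simp: piece_basis_def)
  let ?H = "{w :: nat \<Rightarrow> 'k mpoly. Poly_Mapping.lookup (w j) \<alpha> = 0}"
  have "mvec.span (piece_basis k s - {v}) \<subseteq> ?H"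
  proof (rule mvec.span_minimal)
    show "mvec.subspace ?H"
      by (rule mvec.subspaceI) (auto simp: lookup_add lookup_scalar_mult)
    show "piece_basis k s - {v} \<subseteq> ?H"
      by (auto simp: piece_basis_def ja monomial_vector_def lookup_single when_def)
  qed
  then have "Poly_Mapping.lookup (monomial_vector j \<alpha> j) \<alpha> = (0::'k)" using v(2) ja by blast
  then show False by (simp add: monomial_vector_def)
qed

lemma dim_piece: "mvec.dim (piece k s) = (\<Sum>j=1..b k. card (piece_exponents k s j))"
proof -
  have "mvec.dim (piece k s) = card (piece_basis k s)"
    using mvec.basis_card_eq_dim[OF piece_basis_subset piece_subset_span piece_basis_independent] by simp
  also have "\<dots> = card (SIGMA j:{1..b k}. piece_exponents k s j)"
    unfolding piece_basis_def by (rule card_image, rule inj_on_subset[OF inj_monomial_vector]) simp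
  also have "\<dots> = (\<Sum>j=1..b k. card (piece_exponents k s j))"
    by (intro card_SigmaI) (auto simp: finite_piece_exponents)
  finally show ?thesis .
qed

lemma D_piece:
  assumes "w \<in> piece (k + 1) s"
  shows "D (k + 1) w \<in> piece k s"
proof -
  have "E a k + wdeg d \<gamma> = s" if "\<gamma> \<in> Poly_Mapping.keys (D (k + 1) w a)" for a \<gamma>
  proof -
    have a: "a \<in> {1..b k}" using that by (auto simp: mat_map_def split: if_splits)
    then have "\<gamma> \<in> Poly_Mapping.keys (\<Sum>j=1..b (k + 1). M (k + 1) a j * w j)"
      using that by (simp add: mat_map_def)
    then obtain j where j: "j \<in> {1..b (k + 1)}" "\<gamma> \<in> Poly_Mapping.keys (M (k + 1) a j * w j)"
      using keys_sum_subset[of "\<lambda>j. M (k + 1) a j * w j" "{1..b (k + 1)}"] by blast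
    then obtain \<alpha> \<beta> where *: "\<gamma> = \<alpha> + \<beta>" "\<alpha> \<in> Poly_Mapping.keys (M (k + 1) a j)"
      "\<beta> \<in> Poly_Mapping.keys (w j)"
      using keys_mult[of "M (k + 1) a j" "w j"] by blast
    have "E a k + wdeg d \<alpha> = E j (k + 1)" using entry_degree[of "k + 1" a j \<alpha>] a j(1) *(2) by simp
    moreover have "E j (k + 1) + wdeg d \<beta> = s" using assms *(3) by (auto simp: piece_def)
    ultimately show ?thesis by (simp add: *(1) wdeg_add)
  qed
  moreover have "D (k + 1) w \<in> F k" using assms by (intro D_in_F) (simp add: piece_def)
  ultimately show ?thesis by (auto simp: piece_def)
qed

text \<open>The differentials preserve degrees, so a preimage of a homogeneous vector may be replaced by
  its homogeneous part, and exactness holds in each degree separately.\<close>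

lemma exact_piece: "{v \<in> piece k s. cycle k v} = D (k + 1) ` piece (k + 1) s"
proof
  show "D (k + 1) ` piece (k + 1) s \<subseteq> {v \<in> piece k s. cycle k v}"
  proof (rule image_subsetI)
    fix w assume w: "w \<in> piece (k + 1) s"
    then have "w \<in> F (k + 1)" by (simp add: piece_def)
    then show "D (k + 1) w \<in> {v \<in> piece k s. cycle k v}" using D_piece[OF w] cycle_D by blast
  qed
  show "{v \<in> piece k s. cycle k v} \<subseteq> D (k + 1) ` piece (k + 1) s"
  proof
    fix v assume "v \<in> {v \<in> piece k s. cycle k v}"
    then have v: "v \<in> piece k s" "cycle k v" by auto
    then obtain w where w: "w \<in> F (k + 1)" "D (k + 1) w = v"
      using cycle_imp_boundary[of v k] by (auto simp: piece_def)
    define w' where "w' = (\<lambda>j. part (\<lambda>\<beta>. E j (k + 1) + wdeg d \<beta> = s) (w j))"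
    have "w' \<in> piece (k + 1) s"
      using w(1) by (auto simp: piece_def w'_def keys_part free_module_def poly_ring_part part_0)
    moreover have "D (k + 1) w' = v"
    proof
      fix a
      show "D (k + 1) w' a = v a"
      proof (cases "a \<in> {1..b k}")
        case False
        then show ?thesis using v(1) free_module_outside[of v m "b k" a] by (auto simp: mat_map_def piece_def)
      next
        case True
        have "M (k + 1) a j * w' j = part (\<lambda>\<gamma>. E a k + wdeg d \<gamma> = s) (M (k + 1) a j * w j)"
          if j: "j \<in> {1..b (k + 1)}" for j
          unfolding w'_def
        proof (rule part_mult[symmetric])
          fix \<alpha> \<beta> assume "\<alpha> \<in> Poly_Mapping.keys (M (k + 1) a j)"
          then have "E a k + wdeg d \<alpha> = E j (k + 1)" using entry_degree[of "k + 1" a j \<alpha>] True j by simp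
          then show "E a k + wdeg d (\<alpha> + \<beta>) = s \<longleftrightarrow> E j (k + 1) + wdeg d \<beta> = s"
            by (auto simp: wdeg_add)
        qed
        then have "D (k + 1) w' a = part (\<lambda>\<gamma>. E a k + wdeg d \<gamma> = s) (D (k + 1) w a)"
          using True by (simp add: mat_map_def part_sum)
        also have "\<dots> = v a" unfolding w(2) using v(1) by (intro part_id) (auto simp: piece_def)
        finally show ?thesis .
      qed
    qed
    ultimately show "v \<in> D (k + 1) ` piece (k + 1) s" by blast
  qed
qed

lemma linear_augmentation: "Vector_Spaces.linear scalar_mult smult (\<lambda>v. semigroup_hom d (v 1))"
  unfolding Vector_Spaces.linear_iff
  using vector_space_scalar_mult vector_space_smult
  by (auto simp: semigroup_hom_add scalar_mult_def semigroup_hom_single_mult wdeg_0 monom_0)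

text \<open>The image of the degree \<open>s\<close> part of $F_0$ in the semigroup ring is spanned by $t^s$ if \<open>s\<close> lies
  in the semigroup and is zero otherwise.\<close>

lemma dim_piece_0:
  "mvec.dim (piece 0 s) = mvec.dim (D 1 ` piece 1 s) + of_bool (s \<in> gen_semigroup m d)"
proof -
  let ?f = "\<lambda>v :: nat \<Rightarrow> 'k mpoly. semigroup_hom d (v 1)"
  have dim: "mvec.dim (piece 0 s) = mvec.dim {v \<in> piece 0 s. ?f v = 0} + upoly.dim (?f ` piece 0 s)"
    by (rule mvec_upoly.dim_kernel_plus_dim_image[OF linear_augmentation piece_subspace
          piece_subset_span finite_piece_basis])
  have kernel: "{v \<in> piece 0 s. ?f v = 0} = D 1 ` piece 1 s"
    using exact_piece[of 0 s] by (simp add: cycle_def)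
  have image_subset: "?f ` piece 0 s \<subseteq> upoly.span {monom 1 s}"
  proof safe
    fix v assume "v \<in> piece 0 s"
    then have "wdeg d \<alpha> = s" if "\<alpha> \<in> Poly_Mapping.keys (v 1)" for \<alpha>
      using that E_0 unfolding piece_def by fastforce
    then have "?f v = (\<Sum>\<alpha>\<in>Poly_Mapping.keys (v 1). smult (Poly_Mapping.lookup (v 1) \<alpha>) (monom 1 s))"
      by (simp add: semigroup_hom_def smult_monom)
    also have "\<dots> \<in> upoly.span {monom 1 s}"
      by (intro upoly.span_sum upoly.span_scale upoly.span_base) simp
    finally show "?f v \<in> upoly.span {monom 1 s}" .
  qed
  have "upoly.dim (?f ` piece 0 s) = of_bool (s \<in> gen_semigroup m d)"
  proof (cases "s \<in> gen_semigroup m d")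
    case True
    then obtain \<alpha> where \<alpha>: "\<alpha> \<in> exponents m d s" using gen_semigroup_iff_exponents by blast
    have "monomial_vector 1 \<alpha> \<in> piece 0 s"
      using \<alpha> b_0 E_0 piece_basis_subset[of 0 s]
      by (force simp: piece_basis_def piece_exponents_eq)
    moreover have "?f (monomial_vector 1 \<alpha>) = monom 1 s"
      using \<alpha> by (simp add: monomial_vector_def semigroup_hom_single exponents_def)
    ultimately have "{monom 1 s} \<subseteq> ?f ` piece 0 s" by force
    then have "card {monom (1::'k) s} = upoly.dim (?f ` piece 0 s)"
      using image_subset by (intro upoly.basis_card_eq_dim) auto
    then show ?thesis using True by simp
  next
    case False
    have "piece_exponents 0 s j = {}" if "j \<in> {1..b 0}" for j
      using that False b_0 E_0 gen_semigroup_iff_exponents[of s m d] by (auto simp: piece_exponents_eq)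
    then have "piece_basis 0 s = {}" by (auto simp: piece_basis_def)
    then have "piece 0 s \<subseteq> {0}"
      using piece_subset_span[of 0 s] by simp
    then have "?f ` piece 0 s \<subseteq> upoly.span {}" by (auto simp: semigroup_hom_0)
    then have "upoly.dim (?f ` piece 0 s) = 0"
      using upoly.dim_le_card[of "?f ` piece 0 s" "{}"] by simp
    then show ?thesis using False by simp
  qed
  then show ?thesis using dim kernel by simp
qed

lemma dim_piece_Suc:
  "mvec.dim (piece (Suc k) s) =
     mvec.dim (D (Suc (Suc k)) ` piece (Suc (Suc k)) s) + mvec.dim (D (Suc k) ` piece (Suc k) s)"
proof -
  have "{v \<in> piece (Suc k) s. D (Suc k) v = 0} = D (Suc (Suc k)) ` piece (Suc (Suc k)) s"
    using exact_piece[of "Suc k" s] by (simp add: cycle_def)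
  then show ?thesis
    using mvec_mvec.dim_kernel_plus_dim_image[OF linear_mat_map[of "b k" "b (Suc k)" "M (Suc k)"]
        piece_subspace piece_subset_span finite_piece_basis, of "Suc k" s] by simp
qed

text \<open>By rank and nullity the dimension of each piece is the sum of the ranks of the two adjacent
  differentials. The alternating sum telescopes to the rank of the augmentation, since the rank
  of the differential out of $F_m = 0$ is zero.\<close>

theorem Euler_characteristic_piece:
  "(\<Sum>k<m. (-1) ^ k * int (mvec.dim (piece k s))) = of_bool (s \<in> gen_semigroup m d)"
proof -
  define r where "r k = int (mvec.dim (D (Suc k) ` piece (Suc k) s))" for k
  have "(\<Sum>k<Suc n. (-1) ^ k * int (mvec.dim (piece k s))) =
      of_bool (s \<in> gen_semigroup m d) + (-1) ^ n * r n" for n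
  proof (induction n)
    case 0
    show ?case using dim_piece_0[of s] by (simp add: r_def)
  next
    case (Suc n)
    then show ?case using dim_piece_Suc[of n s] by (simp add: r_def algebra_simps)
  qed
  moreover obtain n where n: "m = Suc n" using m_pos by (cases m) auto
  moreover have "r n = 0"
  proof -
    have "D (Suc n) ` piece (Suc n) s \<subseteq> mvec.span {}"
      using Betti_number_eq_0[of "Suc n"] n by (auto simp: mat_map_def zero_fun_def)
    then show ?thesis
      using mvec.dim_le_card[of "D (Suc n) ` piece (Suc n) s" "{}"] by (simp add: r_def)
  qed
  ultimately show ?thesis by simp
qed

end

section \<open>The Hilbert series\<close>

definition semigroup_fps :: "nat set \<Rightarrow> 'a::comm_ring_1 fps" where
  "semigroup_fps S = Abs_fps (\<lambda>s. of_bool (s \<in> S))"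

context numerical_resolution
begin

definition numerator :: "'a::comm_ring_1 poly" where
  "numerator = (\<Sum>k<m. smult ((-1) ^ k) (\<Sum>j=1..b k. monom 1 (E j k)))"

text \<open>Multiplying the numerator with the Hilbert series of the polynomial ring counts, degree by
  degree, the monomials in the free modules; the alternating sum of these counts is the Euler
  characteristic.\<close>

theorem fps_of_numerator:
  "fps_of_poly numerator = semigroup_fps (gen_semigroup m d) * (\<Prod>i=1..m. 1 - fps_X ^ d i :: 'a::comm_ring_1 fps)"
proof -
  let ?P = "monomial_count_fps m d :: 'a fps"
  have "fps_nth (fps_of_poly numerator * ?P) s = fps_nth (semigroup_fps (gen_semigroup m d)) s" for s
  proof -
    have shifted: "fps_nth (fps_X ^ E j k * ?P) s = of_nat (card (piece_exponents k s j))" for j k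
      by (auto simp: fps_X_power_mult_nth monomial_count_fps_def piece_exponents_eq)
    have "fps_of_poly numerator * ?P =
        (\<Sum>k<m. fps_const ((-1) ^ k) * (\<Sum>j=1..b k. fps_X ^ E j k * ?P))"
      by (simp add: numerator_def fps_of_poly_sum fps_of_poly_smult fps_of_poly_monom'
          sum_distrib_right mult.assoc)
    then have "fps_nth (fps_of_poly numerator * ?P) s =
        (\<Sum>k<m. (-1) ^ k * (\<Sum>j=1..b k. of_nat (card (piece_exponents k s j))))"
      by (simp add: fps_sum_nth shifted)
    also have "\<dots> = of_int (\<Sum>k<m. (-1) ^ k * int (mvec.dim (piece k s)))"
      by (simp add: dim_piece)
    also have "\<dots> = fps_nth (semigroup_fps (gen_semigroup m d)) s"
      unfolding Euler_characteristic_piece by (simp add: semigroup_fps_def)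
    finally show ?thesis .
  qed
  then have "fps_of_poly numerator * ?P = semigroup_fps (gen_semigroup m d)"
    by (rule fps_ext)
  then have "semigroup_fps (gen_semigroup m d) * (\<Prod>i=1..m. 1 - fps_X ^ d i :: 'a fps) =
      fps_of_poly numerator * (?P * (\<Prod>i=1..m. 1 - fps_X ^ d i))"
    by (simp flip: mult.assoc)
  also have "?P * (\<Prod>i=1..m. 1 - fps_X ^ d i) = 1" using d_pos by (rule monomial_count_fps_mult)
  finally show ?thesis by simp
qed

end

lemma int_combination_Gcd:
  fixes d :: "'i \<Rightarrow> nat"
  assumes "finite A"
  shows "\<exists>c. (\<Sum>i\<in>A. c i * int (d i)) = int (Gcd (d ` A))"
  using assms
proof (induction A)
  case empty
  then show ?case by simp
next
  case (insert a A)
  then obtain c where c: "(\<Sum>i\<in>A. c i * int (d i)) = int (Gcd (d ` A))" by blast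
  obtain u v where uv: "u * int (d a) + v * int (Gcd (d ` A)) = gcd (int (d a)) (int (Gcd (d ` A)))"
    using bezout_int by blast
  have "(\<Sum>i\<in>insert a A. (if i = a then u else v * c i) * int (d i)) =
      u * int (d a) + (\<Sum>i\<in>A. v * c i * int (d i))"
    using insert.hyps by (auto intro!: sum.cong)
  also have "(\<Sum>i\<in>A. v * c i * int (d i)) = v * int (Gcd (d ` A))"
    unfolding c[symmetric] by (simp add: sum_distrib_left mult.assoc)
  also have "u * int (d a) + \<dots> = int (Gcd (d ` insert a A))"
    unfolding uv by simp
  finally show ?case by (intro exI[of _ "\<lambda>i. if i = a then u else v * c i"])
qed

text \<open>An integer combination of the generators equal to 1 gives two consecutive elements \<open>a\<close> and
  \<open>a + 1\<close> of the semigroup. If $a > 0$ and $s \ge a^2$, then the quotient of \<open>s\<close> by \<open>a\<close> is at least the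
  remainder, so \<open>s\<close> is a sum of copies of \<open>a\<close> and \<open>a + 1\<close>.\<close>

lemma gen_semigroup_cofinite:
  assumes "Gcd (d ` {1..m}) = 1"
  shows "\<exists>N. \<forall>s\<ge>N. s \<in> gen_semigroup m d"
proof -
  obtain c where c: "(\<Sum>i=1..m. c i * int (d i)) = 1"
    using int_combination_Gcd[of "{1..m}" d] assms by auto
  \<comment> \<open>Positive and negative parts of the coefficients.\<close>
  define x y where "x i = nat (c i)" and "y i = nat (- c i)" for i
  define a where "a = (\<Sum>i=1..m. y i * d i)"
  have "int (\<Sum>i=1..m. x i * d i) = int a + (\<Sum>i=1..m. c i * int (d i))"
    unfolding a_def of_nat_sum sum.distrib[symmetric]
    by (intro sum.cong) (auto simp: x_def y_def algebra_simps)
  then have a1: "(\<Sum>i=1..m. x i * d i) = a + 1"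
    using c by (metis of_nat_1 of_nat_add of_nat_eq_iff)
  have "s \<in> gen_semigroup m d" if s: "a * a \<le> s" for s
  proof -
    obtain u v where uv: "s = u * a + v * (a + 1)"
    proof (cases "a = 0")
      case True
      then show ?thesis using that[of 0 s] by simp
    next
      case False
      then have "s mod a < a" by simp
      moreover have "a \<le> s div a" using s False by (simp add: less_eq_div_iff_mult_less_eq)
      ultimately have le: "s mod a \<le> s div a" by simp
      \<comment> \<open>In \<open>s = (s div a) * a + s mod a\<close> the remainder is spread over \<open>s mod a\<close> of the copies of \<open>a\<close>.\<close>
      have "(s div a - s mod a) * a + s mod a * (a + 1) = (s div a - s mod a + s mod a) * a + s mod a"
        by (simp add: algebra_simps)
      also have "\<dots> = s" using le by simp
      finally show ?thesis using that by metis
    qed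
    have "s = (\<Sum>i=1..m. (u * y i + v * x i) * d i)"
      unfolding uv a1[symmetric] unfolding a_def
      by (simp add: sum_distrib_left sum.distrib algebra_simps)
    then show ?thesis unfolding gen_semigroup_def
      by (intro CollectI exI[of _ "\<lambda>i. u * y i + v * x i"]) simp
  qed
  then show ?thesis by blast
qed

text \<open>The Hilbert series of a cofinite set differs from $1/(1-z)$ by a polynomial, so it has at
  most a simple pole at 1 and no other pole.\<close>

lemma semigroup_fps_times_one_minus_X:
  assumes "\<forall>s\<ge>N. s \<in> S"
  shows "\<exists>g. fps_of_poly g = (1 - fps_X) * (semigroup_fps S :: 'a::comm_ring_1 fps)"
proof -
  let ?f = "(1 - fps_X) * (semigroup_fps S :: 'a fps)"
  have "fps_nth ?f n = 0" if "n > N" for n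
    using that assms by (simp add: left_diff_distrib semigroup_fps_def)
  then have "fps_cutoff (Suc N) ?f = ?f"
    by (intro fps_ext) (auto simp: not_less)
  then have "fps_of_poly (truncate_fps (Suc N) ?f) = ?f" by simp
  then show ?thesis by blast
qed

section \<open>Multiple roots and the Euler operator\<close>

lemma linear_power_dvd_cancel:
  fixes p r :: "'a::idom poly"
  assumes "[:-a, 1:] ^ n dvd p * r" "poly r a \<noteq> 0"
  shows "[:-a, 1:] ^ n dvd p"
proof (cases "p = 0")
  case False
  have "r \<noteq> 0" using assms(2) by auto
  moreover have "order a r = 0" using assms(2) by (rule order_0I)
  ultimately show ?thesis
    using assms(1) False by (simp add: order_divides order_mult)
qed simp

text \<open>The operator $z \frac{d}{dz}$, which multiplies $z^c$ by \<open>c\<close>. Applying it \<open>r\<close> times produces the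
  weights $C^r$ and lowers the multiplicity of a root by at most \<open>r\<close>.\<close>

definition euler_op :: "'a::idom poly \<Rightarrow> 'a poly" where
  "euler_op p = [:0, 1:] * pderiv p"

lemma euler_op_0: "euler_op 0 = 0"
  by (simp add: euler_op_def)

lemma euler_op_add: "euler_op (p + q) = euler_op p + euler_op q"
  by (simp add: euler_op_def pderiv_add distrib_left)

lemma euler_op_smult: "euler_op (smult c p) = smult c (euler_op p)"
  by (simp add: euler_op_def pderiv_smult)

lemma euler_op_sum: "euler_op (sum f A) = (\<Sum>x\<in>A. euler_op (f x))"
  by (induction A rule: infinite_finite_induct) (simp_all add: euler_op_0 euler_op_add)

lemma euler_op_monom: "euler_op (monom c n) = monom (c * of_nat n) n"
  by (cases n) (simp_all add: euler_op_def pderiv_monom mult.commute flip: monom_Suc)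

lemma euler_op_power_sum: "(euler_op ^^ r) (sum f A) = (\<Sum>x\<in>A. (euler_op ^^ r) (f x))"
  by (induction r) (simp_all add: euler_op_sum)

lemma euler_op_power_smult: "(euler_op ^^ r) (smult c p) = smult c ((euler_op ^^ r) p)"
  by (induction r) (simp_all add: euler_op_smult)

lemma euler_op_power_monom: "(euler_op ^^ r) (monom c n) = monom (c * of_nat n ^ r) n"
  by (induction r) (simp_all add: euler_op_monom mult_ac)

lemma euler_op_dvd:
  assumes "[:-a, 1:] ^ Suc n dvd p"
  shows "[:-a, 1:] ^ n dvd euler_op p"
proof -
  let ?l = "[:-a, 1:]"
  obtain u where u: "p = ?l ^ Suc n * u" using assms by (auto elim: dvdE)
  have "pderiv p = ?l ^ n * (?l * pderiv u + smult (of_nat (Suc n)) u)"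
    unfolding u pderiv_mult pderiv_power_Suc
    by (simp add: pderiv_pCons algebra_simps)
  then show ?thesis unfolding euler_op_def by (metis dvd_triv_left dvd_mult)
qed

lemma euler_op_power_root:
  assumes "[:-a, 1:] ^ n dvd p" "r < n"
  shows "poly ((euler_op ^^ r) p) a = 0"
proof -
  have "[:-a, 1:] ^ (n - r) dvd (euler_op ^^ r) p"
    using assms(2)
  proof (induction r)
    case 0
    then show ?case using assms(1) by simp
  next
    case (Suc r)
    then have "[:-a, 1:] ^ Suc (n - Suc r) dvd (euler_op ^^ r) p" by (simp add: Suc_diff_Suc)
    then show ?case using euler_op_dvd by simp
  qed
  moreover have "[:-a, 1:] dvd [:-a, 1:] ^ (n - r)" using assms(2) by (simp add: dvd_power)
  ultimately show ?thesis unfolding poly_eq_0_iff_dvd by (rule dvd_trans[rotated])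
qed

context numerical_resolution
begin

text \<open>Every generator divisible by \<open>q\<close> contributes a factor $1 - z^{d_i}$ vanishing at \<open>\<zeta>\<close>, and the
  Hilbert series has no pole at $\zeta \ne 1$ that could cancel it.\<close>

theorem numerator_multiple_root:
  fixes \<zeta> :: complex
  assumes "Gcd (d ` {1..m}) = 1" "\<zeta> ^ q = 1" "\<zeta> \<noteq> 1"
  shows "[:-\<zeta>, 1:] ^ omega m d q dvd numerator"
proof -
  let ?f = "\<lambda>i. 1 - monom 1 (d i) :: complex poly"
  obtain g where g: "fps_of_poly g = (1 - fps_X) * (semigroup_fps (gen_semigroup m d) :: complex fps)"
    using gen_semigroup_cofinite[OF assms(1)] semigroup_fps_times_one_minus_X by metis
  have "fps_of_poly (numerator * [:1, -1:]) = fps_of_poly numerator * (1 - fps_X :: complex fps)"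
    by (simp only: fps_of_poly_mult fps_of_poly_linear') simp
  also have "\<dots> = fps_of_poly g * (\<Prod>i=1..m. 1 - fps_X ^ d i)"
    unfolding fps_of_numerator g by (simp only: mult_ac)
  also have "\<dots> = fps_of_poly (g * (\<Prod>i=1..m. ?f i))"
    by (simp add: fps_of_poly_mult fps_of_poly_prod fps_of_poly_diff fps_of_poly_monom')
  finally have "fps_of_poly (numerator * [:1, -1:]) = fps_of_poly (g * (\<Prod>i=1..m. ?f i))" .
  then have eq: "numerator * [:1, -1:] = g * (\<Prod>i=1..m. ?f i)"
    by (simp only: fps_of_poly_eq_iff)
  let ?A = "{i \<in> {1..m}. q dvd d i}"
  have "[:-\<zeta>, 1:] dvd ?f i" if "q dvd d i" for i
    using that assms(2) by (auto simp: poly_monom power_mult elim!: dvdE simp flip: poly_eq_0_iff_dvd)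
  then have "(\<Prod>i\<in>?A. [:-\<zeta>, 1:]) dvd (\<Prod>i\<in>?A. ?f i)" by (intro prod_dvd_prod) auto
  then have "[:-\<zeta>, 1:] ^ omega m d q dvd (\<Prod>i\<in>?A. ?f i)" by (simp add: omega_def)
  also have "(\<Prod>i\<in>?A. ?f i) dvd (\<Prod>i=1..m. ?f i)" by (intro prod_dvd_prod_subset) auto
  finally have "[:-\<zeta>, 1:] ^ omega m d q dvd numerator * [:1, -1:]" unfolding eq by simp
  moreover have "poly [:1, -1:] \<zeta> \<noteq> 0" using assms(3) by simp
  ultimately show ?thesis by (rule linear_power_dvd_cancel)
qed

text \<open>The right-hand side is the contribution of the constant term 1 of the numerator, moved to
  the other side; it vanishes unless \<open>r = 0\<close>.\<close>

theorem syzygy_power_sums: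
  fixes \<zeta> :: complex
  assumes "Gcd (d ` {1..m}) = 1" "\<zeta> ^ q = 1" "\<zeta> \<noteq> 1" "r < omega m d q"
  shows "(\<Sum>k=1..m-1. (-1) ^ (k - 1) * (\<Sum>j=1..b k. of_nat (E j k) ^ r * \<zeta> ^ E j k)) = 0 ^ r"
proof -
  let ?T = "\<lambda>k. \<Sum>j=1..b k. of_nat (E j k) ^ r * \<zeta> ^ E j k"
  have "0 = poly ((euler_op ^^ r) numerator) \<zeta>"
    using euler_op_power_root[OF numerator_multiple_root[OF assms(1-3)] assms(4)] by simp
  also have "\<dots> = (\<Sum>k<m. (-1) ^ k * ?T k)"
    by (simp add: numerator_def euler_op_power_sum euler_op_power_smult euler_op_power_monom
        poly_sum poly_monom)
  also have "{..<m} = insert 0 {1..m-1}" using m_pos by auto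
  also have "(\<Sum>k\<in>insert 0 {1..m-1}. (-1) ^ k * ?T k) = ?T 0 + (\<Sum>k=1..m-1. (-1) ^ k * ?T k)"
    by (subst sum.insert) auto
  also have "?T 0 = 0 ^ r" using b_0 E_0 by simp
  also have "(\<Sum>k=1..m-1. (-1) ^ k * ?T k) = - (\<Sum>k=1..m-1. (-1) ^ (k - 1) * ?T k)"
    unfolding sum_negf[symmetric]
  proof (rule sum.cong[OF refl])
    fix k assume "k \<in> {1..m-1}"
    then obtain l where "k = Suc l" by (cases k) auto
    then show "(-1) ^ k * ?T k = - ((-1) ^ (k - 1) * ?T k)" by simp
  qed
  finally show ?thesis by simp
qed

end

section \<open>Cancellation\<close>

text \<open>The two removed terms sit in homological degrees of different parity, so their contributions
  to any alternating sum are opposite.\<close>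

lemma cancel_step_alternating_sum:
  fixes f :: "nat \<Rightarrow> 'a::comm_ring_1"
  assumes "cancel_step m D D'"
  shows "(\<Sum>k=1..m-1. (-1) ^ (k - 1) * sum_mset (image_mset f (D' k))) =
         (\<Sum>k=1..m-1. (-1) ^ (k - 1) * sum_mset (image_mset f (D k)))"
proof -
  obtain k l t where kl: "k \<in> {1..m-1}" "l \<in> {1..m-1}" "odd (k + l)" "t \<in># D k" "t \<in># D l"
    "D' = D(k := D k - {#t#}, l := D l - {#t#})"
    using assms unfolding cancel_step_def by blast
  let ?S = "\<lambda>D i. sum_mset (image_mset f (D i))"
  have "k \<noteq> l" using kl(3) by auto
  have rem: "sum_mset (image_mset f (D i - {#t#})) = ?S D i - f t" if "t \<in># D i" for i
    using that by (metis add_diff_cancel_left' image_mset_add_mset insert_DiffM sum_mset.add_mset)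
  have "(-1) ^ (i - 1) * ?S D' i = (-1) ^ (i - 1) * ?S D i -
      ((if i = k then (-1) ^ (k - 1) * f t else 0) + (if i = l then (-1) ^ (l - 1) * f t else 0))" for i
    using kl rem \<open>k \<noteq> l\<close> by (auto simp: algebra_simps)
  then have "(\<Sum>i=1..m-1. (-1) ^ (i - 1) * ?S D' i) = (\<Sum>i=1..m-1. (-1) ^ (i - 1) * ?S D i) -
      ((-1) ^ (k - 1) * f t + (-1) ^ (l - 1) * f t)"
    using kl(1,2) by (simp add: sum_subtractf sum.distrib sum.delta)
  moreover have "(-1) ^ (k - 1) + (-1) ^ (l - 1) = (0 :: 'a)"
  proof -
    obtain k' l' where "k = Suc k'" "l = Suc l'" using kl(1,2) by (cases k; cases l) auto
    then show ?thesis using kl(3) by (cases "even k'") auto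
  qed
  ultimately show ?thesis by (simp flip: distrib_right)
qed

lemma cancellation_alternating_sum:
  fixes f :: "nat \<Rightarrow> 'a::comm_ring_1"
  assumes "(cancel_step m)\<^sup>*\<^sup>* (degrees b E) (degrees \<beta> C)"
  shows "(\<Sum>k=1..m-1. (-1) ^ (k - 1) * (\<Sum>j=1..\<beta> k. f (C j k))) =
         (\<Sum>k=1..m-1. (-1) ^ (k - 1) * (\<Sum>j=1..b k. f (E j k)))"
proof -
  have sum_eq: "(\<Sum>j=1..b' k. f (E' j k)) = sum_mset (image_mset f (degrees b' E' k))" for b' E' k
    by (simp add: degrees_def sum_unfold_sum_mset image_mset.compositionality comp_def)
  show ?thesis
    unfolding sum_eq using assms
  proof (induction rule: rtranclp_induct)
    case (step D D')
    then show ?case using cancel_step_alternating_sum[of m D D' f] by simp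
  qed simp
qed

theorem theorem2:
  fixes m :: nat and d :: "nat \<Rightarrow> nat"
    and b :: "nat \<Rightarrow> nat" and E :: "nat \<Rightarrow> nat \<Rightarrow> nat"
    and M :: "nat \<Rightarrow> nat \<Rightarrow> nat \<Rightarrow> ('k::field) mpoly"
    and \<beta> :: "nat \<Rightarrow> nat" and C :: "nat \<Rightarrow> nat \<Rightarrow> nat"
    and q n :: nat
  assumes "3 \<le> m"
    and "minimal_generators m d"
    and "syzygy_degrees m d b E M \<beta> C"
    and "1 < q" and "q \<le> Max (d ` {1..m})" and "1 \<le> omega m d q"
    and "coprime n q" and "1 \<le> n" and "real n < real q / 2"
  shows "(\<forall>r\<in>{1..omega m d q - 1}.
           (\<Sum>k=1..m-1. (-1) ^ (k - 1) *
             (\<Sum>j=1..\<beta> k. of_nat (C j k) ^ r *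
               exp (\<i> * complex_of_real (2 * pi * real n / real q) * of_nat (C j k)))) = 0)
       \<and> (\<Sum>k=1..m-1. (-1) ^ (k - 1) *
           (\<Sum>j=1..\<beta> k.
             exp (\<i> * complex_of_real (2 * pi * real n / real q) * of_nat (C j k)))) = 1"
proof -
  interpret numerical_resolution m d b E M
    using assms(1-3) by unfold_locales (auto simp: minimal_generators_def syzygy_degrees_def)
  define \<zeta> where "\<zeta> = exp (\<i> * complex_of_real (2 * pi * real n / real q))"
  have exp_eq: "exp (\<i> * complex_of_real (2 * pi * real n / real q) * of_nat c) = \<zeta> ^ c" for c
    unfolding \<zeta>_def exp_of_nat_mult[symmetric] by (simp add: mult.commute)
  have "\<zeta> ^ q = exp (2 * pi * \<i>) ^ n"
    using assms(4) unfolding exp_eq[symmetric] exp_of_nat_mult[symmetric] by (simp add: mult_ac)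
  then have root: "\<zeta> ^ q = 1" by simp
  \<comment> \<open>The angle lies strictly between 0 and \<open>\<pi>\<close>, so the root of unity is not 1.\<close>
  have "0 < 2 * pi * real n / real q" "2 * pi * real n / real q < pi"
    using assms(4,8,9) by (auto simp: field_simps)
  then have "0 < Im \<zeta>" unfolding \<zeta>_def cis_conv_exp[symmetric] by (simp add: sin_gt_zero)
  then have "\<zeta> \<noteq> 1" by auto
  have gcd: "Gcd (d ` {1..m}) = 1" using assms(2) by (simp add: minimal_generators_def)
  have main: "(\<Sum>k=1..m-1. (-1) ^ (k - 1) * (\<Sum>j=1..\<beta> k. of_nat (C j k) ^ r * \<zeta> ^ C j k)) = 0 ^ r"
    if "r < omega m d q" for r
  proof -
    have "(cancel_step m)\<^sup>*\<^sup>* (degrees b E) (degrees \<beta> C)"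
      using assms(3) by (simp add: syzygy_degrees_def)
    from cancellation_alternating_sum[OF this, of "\<lambda>c. of_nat c ^ r * \<zeta> ^ c"]
    show ?thesis using syzygy_power_sums[OF gcd root \<open>\<zeta> \<noteq> 1\<close> that] by simp
  qed
  show ?thesis
    unfolding exp_eq
  proof (intro conjI ballI)
    fix r assume "r \<in> {1..omega m d q - 1}"
    then show "(\<Sum>k=1..m-1. (-1) ^ (k - 1) * (\<Sum>j=1..\<beta> k. of_nat (C j k) ^ r * \<zeta> ^ C j k)) = 0"
      using main[of r] by auto
  next
    show "(\<Sum>k=1..m-1. (-1) ^ (k - 1) * (\<Sum>j=1..\<beta> k. \<zeta> ^ C j k)) = 1"
      using main[of 0] assms(6) by simp
  qed
qed

end
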